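(* Let $(X_n)_{n\ge1}$ be i.i.d. random variables of law $\nu$ on a probability space $(\Omega,\mathcal A,P)$ with values in a measurable space $(U,\mathcal U)$. Let $\mathcal W\subset\mathcal U$ be a Vapnik-Cervonenkis class of sets and let $\mathcal B_{\#}$ be a Vapnik-Cervonenkis class of regular Borel subsets of $[0,1]$. For $B\in\mathcal B_\#$, $W\in\mathcal W$, put $\mathbb P_n(B\times W)=\frac1n\sum_{i=1}^n\mathbf 1_B(i/n)\mathbf 1_W(X_i)$. Then $$P\left(\lim_{n\to+\infty}\sup_{B\in\mathcal B_\#}\sup_{W\in\mathcal W}\left|\mathbb P_n(B\times W)-\lambda_n(B)\nu(W)\right|=0\right)=1.$$ If, moreover, $\lim_{n\to+\infty}\sup_{B\in\mathcal B_\#}|\lambda_n(B)-\lambda(B)|=0$, then $$P\left(\lim_{n\to+\infty}\sup_{B\in\mathcal B_\#}\sup_{W\in\mathcal W}\left|\mathbb P_n(B\times W)-\lambda(B)\nu(W)\right|=0\right)=1.$$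
   Context: $\lambda_n=\frac1n\sum_{i=1}^n\delta_{i/n}$ is the discrete uniform measure on $[0,1]$ and $\lambda$ is Lebesgue measure on $[0,1]$. A Borel set $B\subset[0,1]$ is regular if $\lambda(B)>0$ and $\lambda(\partial B)=0$, where $\partial B$ is the boundary of $B$. A class of sets is a Vapnik-Cervonenkis class if the largest cardinality of a finite set shattered by it (its V.C. dimension) is finite. Standing assumption: the classes of indicator functions of the sets in $\mathcal W$ and in $\mathcal B_\#$, and of the products $\mathbf 1_B\mathbf 1_W$, are permissible. Here a class $\mathcal F$ of functions on a measurable space $(S,\mathcal S)$ is permissible (Pollard 1984, Appendix C) if it can be indexed as $\mathcal F=\{f(\cdot,t):t\in T\}$, where $T$ is an analytic (Suslin) subset of a compact metric space, equipped with its Borel $\sigma$-field $\mathcal B(T)$, and $(x,t)\mapsto f(x,t)$ is $\mathcal S\otimes\mathcal B(T)$-measurable. This serves to avoid measurability problems with suprema, which are understood as random variables with respect to the completion of $P$. *)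

theory Defs
  imports "HOL-Probability.Probability"
begin

definition shatters :: "'a set set \<Rightarrow> 'a set \<Rightarrow> bool" where
  "shatters \<C> A \<longleftrightarrow> (\<forall>D\<subseteq>A. \<exists>C\<in>\<C>. C \<inter> A = D)"

definition vc_dim :: "'a set set \<Rightarrow> enat" where
  "vc_dim \<C> = (SUP A\<in>{A. finite A \<and> shatters \<C> A}. enat (card A))"

definition VC_class :: "'a set set \<Rightarrow> bool" where
  "VC_class \<C> \<longleftrightarrow> vc_dim \<C> < \<infinity>"

text \<open>The frontier is taken in the real line. For a subset of the unit interval it differs from
  the boundary relative to the unit interval by at most the two end points, a null set.\<close>

definition regular_set :: "real set \<Rightarrow> bool" where
  "regular_set B \<longleftrightarrow> B \<in> sets borel \<and> B \<subseteq> {0..1} \<and>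
     emeasure lborel B > 0 \<and> emeasure lborel (frontier B) = 0"

text \<open>Analytic (Suslin) sets: results of the Suslin operation applied to a scheme of closed sets.
  The finite sequence \<open>map x [0..<n]\<close> is the initial segment of length \<open>n\<close> of \<open>x\<close>.
  For a subset of a compact set \<open>K\<close> of a metric space it does not matter whether the closed sets
  are taken in \<open>K\<close> or in the whole space.\<close>

definition analytic_set :: "'a::topological_space set \<Rightarrow> bool" where
  "analytic_set A \<longleftrightarrow> (\<exists>C :: nat list \<Rightarrow> 'a set.
     (\<forall>s. closed (C s)) \<and> A = (\<Union>x :: nat \<Rightarrow> nat. \<Inter>n. C (map x [0..<n])))"

text \<open>A definition cannot quantify over types, so the metric space containing the compact
  parameter space is passed as a type argument. A theorem assuming permissibility with a free type
  variable here covers every compact metric space.\<close>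

definition permissible :: "'t::metric_space itself \<Rightarrow> 'a measure \<Rightarrow> ('a \<Rightarrow> real) set \<Rightarrow> bool" where
  "permissible _ S \<F> \<longleftrightarrow> (\<exists>(K :: 't set) T (f :: 'a \<Rightarrow> 't \<Rightarrow> real).
     compact K \<and> T \<subseteq> K \<and> analytic_set T \<and>
     \<F> = {(\<lambda>x. f x t) | t. t \<in> T} \<and>
     (\<lambda>(x, t). f x t) \<in> borel_measurable (S \<Otimes>\<^sub>M restrict_space borel T))"

definition unit_interval :: "real measure" where
  "unit_interval = restrict_space borel {0..1}"

definition grid_measure :: "nat \<Rightarrow> real measure" where
  "grid_measure n = distr (uniform_count_measure {1..n}) unit_interval (\<lambda>i. real i / real n)"

lemma measure_grid_measure:
  assumes "B \<in> sets borel" "B \<subseteq> {0..1}"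
  shows "measure (grid_measure n) B = (\<Sum>i=1..n. indicator B (real i / real n)) / real n"
proof -
  have B: "B \<in> sets unit_interval"
    using assms by (auto simp: unit_interval_def sets_restrict_space)
  have m: "(\<lambda>i. real i / real n) \<in> measurable (uniform_count_measure {1..n}) unit_interval"
    unfolding unit_interval_def
    by (rule measurable_restrict_space2)
       (auto simp: space_uniform_count_measure sets_uniform_count_measure measurable_def)
  have "measure (grid_measure n) B =
      measure (uniform_count_measure {1..n}) ((\<lambda>i. real i / real n) -` B \<inter> {1..n})"
    unfolding grid_measure_def
    by (subst measure_distr[OF m B]) (simp add: space_uniform_count_measure)
  also have "\<dots> = card ((\<lambda>i. real i / real n) -` B \<inter> {1..n}) / real n"
    by (subst measure_uniform_count_measure) auto
  also have "real (card ((\<lambda>i. real i / real n) -` B \<inter> {1..n})) =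
      (\<Sum>i=1..n. indicator B (real i / real n))"
    by (simp add: indicator_def sum.If_cases Int_commute vimage_def Collect_conj_eq)
  finally show ?thesis .
qed

definition emp_prod :: "(nat \<Rightarrow> 'u) \<Rightarrow> nat \<Rightarrow> real set \<Rightarrow> 'u set \<Rightarrow> real" where
  "emp_prod x n B W =
     (\<Sum>i=1..n. indicator B (real i / real n) * indicator W (x i)) / real n"

end

theory Submission
  imports Defs
begin

text \<open>
  For fixed \<open>n\<close> the quantity for \<open>B\<close> and \<open>W\<close> depends on \<open>B\<close> only through the set \<open>I\<close> of indices \<open>i \<le> n\<close>
  with \<open>i / n \<in> B\<close>, and by the Sauer--Shelah lemma there are only polynomially many such sets. For
  each \<open>I\<close> one needs an exponential bound for the deviation of \<open>\<Sum>i\<in>I. indicator W (X i)\<close> from its mean,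
  uniformly in \<open>W\<close>: a ghost sample and random swaps reduce it to Hoeffding's bound for Rademacher
  sums and the Sauer--Shelah lemma for \<open>\<W>\<close>. A union bound over \<open>I\<close> and the Borel--Cantelli lemma
  conclude.

  Permissibility enters once: the symmetrized deviation event is the projection along the analytic
  parameter set of a product-measurable set, hence measurable for the completion, and so is
  approximated from inside by measurable sets to which the swapping argument applies. The events
  for the original sample are only covered by measurable sets, and the final event contains
  one of full measure, so its measurability for the completion is automatic.
\<close>

section \<open>Suslin sets and measurable projection\<close>

text \<open>The pairs \<open>(i / n, X i)\<close> are independent but not identically distributed,
  so the classical uniform law for i.i.d. samples does not apply to the sets
  \<open>B \<times> W\<close>. Freezing the index set \<open>I\<close> leaves sums of identically
  distributed terms; the price is a bound for every \<open>I\<close> inside \<open>{1..n}\<close>,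
  with a rate governed by \<open>n\<close> and not by \<open>card I\<close>. The budget at threshold
  \<open>t\<close>: the ghost sample costs a factor 2 and half of the threshold, provided
  \<open>4 * n \<le> t\<^sup>2\<close>; Hoeffding's bound for at most \<open>n\<close> signs at
  \<open>t / 2\<close> gives \<open>2 * exp (- t\<^sup>2 / (8 * n))\<close>; there are at most
  \<open>(2 * n + 1) ^ d\<close> traces on both samples together and \<open>(n + 1) ^ d'\<close>
  index sets. With \<open>t = n * \<epsilon>\<close> the polynomial factors lose against
  \<open>exp (- \<epsilon>\<^sup>2 * n / 8)\<close>. The obstacle is a mismatch: averaging over
  swaps bounds measurable sets inside the symmetrized event, whereas the Fubini argument of the
  ghost step needs a measurable set containing it. The two fit together once the event is measurable
  up to a null set, which is what measurable projection provides.\<close>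

text \<open>The sets obtained from \<open>\<R>\<close> by the Suslin operation. Instead of a scheme indexed by finite
  sequences, each \<open>Q m\<close> is only required to be locally constant on the Baire space; this makes the
  class closed under countable unions and intersections by mere recoding of \<open>x\<close>.\<close>

definition suslin :: "'a set set \<Rightarrow> 'a set \<Rightarrow> bool" where
  "suslin \<R> E \<longleftrightarrow> (\<exists>Q :: nat \<Rightarrow> (nat \<Rightarrow> nat) \<Rightarrow> 'a set.
     (\<forall>m x. Q m x \<in> \<R>) \<and> (\<forall>m x. \<exists>N. \<forall>y. (\<forall>i<N. y i = x i) \<longrightarrow> Q m y = Q m x) \<and>
     E = (\<Union>x. \<Inter>m. Q m x))"

lemma suslinE:
  fixes E :: "'a set"
  assumes "suslin \<R> E"
  obtains Q :: "nat \<Rightarrow> (nat \<Rightarrow> nat) \<Rightarrow> 'a set" where "\<And>m x. Q m x \<in> \<R>"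
    "\<And>m x. \<exists>N. \<forall>y. (\<forall>i<N. y i = x i) \<longrightarrow> Q m y = Q m x" "E = (\<Union>x. \<Inter>m. Q m x)"
  using assms[unfolded suslin_def]
proof (elim exE conjE)
  fix Q :: "nat \<Rightarrow> (nat \<Rightarrow> nat) \<Rightarrow> 'a set"
  assume "\<forall>m x. Q m x \<in> \<R>" "\<forall>m x. \<exists>N. \<forall>y. (\<forall>i<N. y i = x i) \<longrightarrow> Q m y = Q m x"
    and E: "E = (\<Union>x. \<Inter>m. Q m x)"
  then show thesis by (intro that[OF _ _ E]) simp_all
qed

lemma suslin_member: "E \<in> \<R> \<Longrightarrow> suslin \<R> E"
  unfolding suslin_def by (rule exI[of _ "\<lambda>m x. E"]) auto

lemma suslin_Union:
  fixes E :: "nat \<Rightarrow> 'a set"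
  assumes "\<And>k. suslin \<R> (E k)"
  shows "suslin \<R> (\<Union>k. E k)"
proof -
  have "\<exists>Q :: nat \<Rightarrow> (nat \<Rightarrow> nat) \<Rightarrow> 'a set. (\<forall>m x. Q m x \<in> \<R>) \<and>
     (\<forall>m x. \<exists>N. \<forall>y. (\<forall>i<N. y i = x i) \<longrightarrow> Q m y = Q m x) \<and>
     E k = (\<Union>x. \<Inter>m. Q m x)" for k
    using assms[of k] unfolding suslin_def .
  then obtain Q :: "nat \<Rightarrow> nat \<Rightarrow> (nat \<Rightarrow> nat) \<Rightarrow> 'a set" where Q: "\<And>k m x. Q k m x \<in> \<R>"
    "\<And>k m x. \<exists>N. \<forall>y. (\<forall>i<N. y i = x i) \<longrightarrow> Q k m y = Q k m x"
    "\<And>k. E k = (\<Union>x. \<Inter>m. Q k m x)"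
    by metis
  \<comment> \<open>The coordinate \<open>x 0\<close> selects the member of the union; the shifted
    sequence runs through its scheme.\<close>
  define R where "R m x = Q (x 0) m (\<lambda>j. x (Suc j))" for m x
  have "\<exists>N. \<forall>y. (\<forall>i<N. y i = x i) \<longrightarrow> R m y = R m x" for m x
  proof -
    obtain N where N: "\<forall>y. (\<forall>i<N. y i = x (Suc i)) \<longrightarrow> Q (x 0) m y = Q (x 0) m (\<lambda>j. x (Suc j))"
      using Q(2)[of "\<lambda>j. x (Suc j)" "x 0" m] by auto
    show ?thesis
    proof (rule exI[of _ "Suc N"], intro allI impI)
      fix y assume y: "\<forall>i<Suc N. y i = x i"
      then have "Q (x 0) m (\<lambda>j. y (Suc j)) = Q (x 0) m (\<lambda>j. x (Suc j))"
        by (intro N[rule_format]) simp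
      then show "R m y = R m x" using y by (simp add: R_def)
    qed
  qed
  moreover have "(\<Union>k. E k) = (\<Union>x. \<Inter>m. R m x)"
  proof (intro equalityI subsetI)
    fix z assume "z \<in> (\<Union>k. E k)"
    then obtain k x where "\<And>m. z \<in> Q k m x" unfolding Q(3) by auto
    then have "\<And>m. z \<in> R m (case_nat k x)" by (simp add: R_def)
    then show "z \<in> (\<Union>x. \<Inter>m. R m x)" by blast
  next
    fix z assume "z \<in> (\<Union>x. \<Inter>m. R m x)"
    then show "z \<in> (\<Union>k. E k)" unfolding Q(3) R_def by blast
  qed
  moreover have "R m x \<in> \<R>" for m x by (simp add: R_def Q)
  ultimately show ?thesis unfolding suslin_def by blast
qed

lemma suslin_Inter:
  fixes E :: "nat \<Rightarrow> 'a set"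
  assumes "\<And>k. suslin \<R> (E k)"
  shows "suslin \<R> (\<Inter>k. E k)"
proof -
  have "\<exists>Q :: nat \<Rightarrow> (nat \<Rightarrow> nat) \<Rightarrow> 'a set. (\<forall>m x. Q m x \<in> \<R>) \<and>
     (\<forall>m x. \<exists>N. \<forall>y. (\<forall>i<N. y i = x i) \<longrightarrow> Q m y = Q m x) \<and>
     E k = (\<Union>x. \<Inter>m. Q m x)" for k
    using assms[of k] unfolding suslin_def .
  then obtain Q :: "nat \<Rightarrow> nat \<Rightarrow> (nat \<Rightarrow> nat) \<Rightarrow> 'a set" where Q: "\<And>k m x. Q k m x \<in> \<R>"
    "\<And>k m x. \<exists>N. \<forall>y. (\<forall>i<N. y i = x i) \<longrightarrow> Q k m y = Q k m x"
    "\<And>k. E k = (\<Union>x. \<Inter>m. Q k m x)"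
    by metis
  \<comment> \<open>The pairing function lets one sequence carry a separate branch for each
    \<open>k\<close>, since the sets \<open>E k\<close> may need different witnesses.\<close>
  define R where "R m x = (case prod_decode m of (k, n) \<Rightarrow> Q k n (\<lambda>j. x (prod_encode (k, j))))"
    for m x
  have "\<exists>N. \<forall>y. (\<forall>i<N. y i = x i) \<longrightarrow> R m y = R m x" for m x
  proof -
    obtain k n where m: "prod_decode m = (k, n)" by force
    obtain N where N: "\<forall>y. (\<forall>i<N. y i = x (prod_encode (k, i))) \<longrightarrow>
        Q k n y = Q k n (\<lambda>j. x (prod_encode (k, j)))"
      using Q(2)[of "\<lambda>j. x (prod_encode (k, j))" k n] by auto
    \<comment> \<open>The sum is only a crude upper bound for the finitely many codes
      \<open>prod_encode (k, i)\<close> with \<open>i < N\<close>.\<close>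
    show ?thesis
    proof (rule exI[of _ "Suc (\<Sum>i<N. prod_encode (k, i))"], intro allI impI)
      fix y assume y: "\<forall>i<Suc (\<Sum>i<N. prod_encode (k, i)). y i = x i"
      have "y (prod_encode (k, i)) = x (prod_encode (k, i))" if "i < N" for i
        using that member_le_sum[of i "{..<N}" "\<lambda>i. prod_encode (k, i)"] y
        by (simp add: less_Suc_eq_le)
      then have "Q k n (\<lambda>j. y (prod_encode (k, j))) = Q k n (\<lambda>j. x (prod_encode (k, j)))"
        by (intro N[rule_format]) simp
      then show "R m y = R m x" unfolding R_def m by simp
    qed
  qed
  moreover have "(\<Inter>k. E k) = (\<Union>x. \<Inter>m. R m x)"
  proof (intro equalityI subsetI)
    fix z assume "z \<in> (\<Inter>k. E k)"
    then have "\<forall>k. \<exists>x. \<forall>m. z \<in> Q k m x" unfolding Q(3) by auto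
    then obtain x where x: "\<And>k m. z \<in> Q k m (x k)" by metis
    have "z \<in> R m (\<lambda>i. case prod_decode i of (k, j) \<Rightarrow> x k j)" for m
      by (simp add: R_def x split: prod.split)
    then show "z \<in> (\<Union>x. \<Inter>m. R m x)" by blast
  next
    fix z assume "z \<in> (\<Union>x. \<Inter>m. R m x)"
    then obtain x where x: "\<And>m. z \<in> R m x" by auto
    have "z \<in> Q k n (\<lambda>j. x (prod_encode (k, j)))" for k n
      using x[of "prod_encode (k, n)"] by (simp add: R_def)
    then show "z \<in> (\<Inter>k. E k)" unfolding Q(3) by blast
  qed
  moreover have "R m x \<in> \<R>" for m x by (simp add: R_def Q split: prod.split)
  ultimately show ?thesis unfolding suslin_def by blast
qed

lemma suslin_Int:
  assumes "suslin \<R> A" "suslin \<R> B"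
  shows "suslin \<R> (A \<inter> B)"
proof -
  have "A \<inter> B = (\<Inter>k::nat. if k = 0 then A else B)"
    by (auto split: if_splits)
  with suslin_Inter[of \<R> "\<lambda>k. if k = 0 then A else B"] assms show ?thesis by simp
qed

text \<open>Restores the usual form of a Suslin scheme, where level \<open>n\<close> reads only
  \<open>n\<close> coordinates and the levels decrease. Both the capacity argument and the
  compactness argument below rely on it.\<close>

lemma suslin_decreasing_scheme:
  fixes E :: "'a set"
  assumes E: "suslin \<R> E" and S: "S \<in> \<R>" "\<And>A. A \<in> \<R> \<Longrightarrow> A \<subseteq> S"
    and Int: "\<And>A B. A \<in> \<R> \<Longrightarrow> B \<in> \<R> \<Longrightarrow> A \<inter> B \<in> \<R>"
  obtains R :: "nat \<Rightarrow> (nat \<Rightarrow> nat) \<Rightarrow> 'a set" where "\<And>n x. R n x \<in> \<R>"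
    "\<forall>n x y. (\<forall>i<n. y i = x i) \<longrightarrow> R n y = R n x"
    "\<And>n x. R (Suc n) x \<subseteq> R n x" "E = (\<Union>x. \<Inter>n. R n x)"
proof -
  obtain Q :: "nat \<Rightarrow> (nat \<Rightarrow> nat) \<Rightarrow> 'a set" where Q: "\<And>m x. Q m x \<in> \<R>"
    "\<And>m x. \<exists>N. \<forall>y. (\<forall>i<N. y i = x i) \<longrightarrow> Q m y = Q m x" "E = (\<Union>x. \<Inter>m. Q m x)"
    using E by (rule suslinE) blast
  \<comment> \<open>These are the indices whose set is already decided by the first \<open>n\<close>
    coordinates. Every \<open>m\<close> enters eventually, so nothing is lost in the limit.\<close>
  define J where "J n x = {m. m < n \<and> (\<forall>y. (\<forall>i<n. y i = x i) \<longrightarrow> Q m y = Q m x)}" for n x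
  \<comment> \<open>The factor \<open>S\<close> takes care of an empty \<open>J n x\<close>.\<close>
  define R where "R n x = S \<inter> (\<Inter>m\<in>J n x. Q m x)" for n x
  have *: "S \<inter> (\<Inter>m\<in>K. Q m x) \<in> \<R>" if "finite K" for K x
    using that
  proof (induction K rule: finite_induct)
    case (insert k K)
    have "S \<inter> (\<Inter>m\<in>insert k K. Q m x) = Q k x \<inter> (S \<inter> (\<Inter>m\<in>K. Q m x))" by auto
    then show ?case using Int[OF Q(1) insert.IH] by simp
  qed (simp add: S)
  have "finite (J n x)" for n x by (rule finite_subset[of _ "{..<n}"]) (auto simp: J_def)
  then have 1: "R n x \<in> \<R>" for n x unfolding R_def by (rule *)
  have J: "J n x \<subseteq> J n y" "\<And>m. m \<in> J n x \<Longrightarrow> Q m y = Q m x"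
    if xy: "\<forall>i<n. y i = x i" for n x y
  proof -
    show Q_eq: "Q m y = Q m x" if "m \<in> J n x" for m
    proof -
      have "\<forall>y. (\<forall>i<n. y i = x i) \<longrightarrow> Q m y = Q m x"
        using that unfolding J_def mem_Collect_eq by (rule conjunct2)
      from this[rule_format, of y] xy show ?thesis by blast
    qed
    show "J n x \<subseteq> J n y"
    proof
      fix m assume m: "m \<in> J n x"
      then have *: "m < n \<and> (\<forall>y. (\<forall>i<n. y i = x i) \<longrightarrow> Q m y = Q m x)"
        unfolding J_def mem_Collect_eq .
      have "Q m w = Q m y" if "\<forall>i<n. w i = y i" for w
        using conjunct2[OF *, rule_format, of w] that xy Q_eq[OF m] by simp
      then show "m \<in> J n y" using conjunct1[OF *] unfolding J_def mem_Collect_eq by blast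
    qed
  qed
  have 2: "R n y = R n x" if xy: "\<forall>i<n. y i = x i" for n x y
  proof -
    have "\<forall>i<n. x i = y i" using xy by simp
    then have "J n y = J n x" using J(1)[OF xy] J(1)[of n x y] by blast
    moreover have "(\<Inter>m\<in>J n x. Q m y) = (\<Inter>m\<in>J n x. Q m x)"
      by (intro INF_cong refl J(2)[OF xy])
    ultimately show ?thesis unfolding R_def by simp
  qed
  have "J n x \<subseteq> J (Suc n) x" for n x
  proof
    show "m \<in> J (Suc n) x" if "m \<in> J n x" for m
      using that unfolding J_def mem_Collect_eq by (metis less_SucI)
  qed
  then have 3: "R (Suc n) x \<subseteq> R n x" for n x unfolding R_def by blast
  have "(\<Inter>n. R n x) = (\<Inter>m. Q m x)" for x
  proof (intro equalityI subsetI)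
    fix z assume z: "z \<in> (\<Inter>n. R n x)"
    have "z \<in> Q m x" for m
    proof -
      obtain N where "\<forall>y. (\<forall>i<N. y i = x i) \<longrightarrow> Q m y = Q m x" using Q(2) by blast
      then have "\<forall>y. (\<forall>i<Suc m + N. y i = x i) \<longrightarrow> Q m y = Q m x" by (metis trans_less_add2)
      moreover have "m < Suc m + N" by simp
      ultimately have "m \<in> J (Suc m + N) x" unfolding J_def mem_Collect_eq by (intro conjI)
      then show ?thesis using z by (auto simp: R_def)
    qed
    then show "z \<in> (\<Inter>m. Q m x)" by auto
  next
    fix z assume "z \<in> (\<Inter>m. Q m x)"
    then show "z \<in> (\<Inter>n. R n x)" unfolding R_def using S(2)[OF Q(1)] by auto
  qed
  then have "E = (\<Union>x. \<Inter>n. R n x)" using Q(3) by simp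
  moreover have "\<forall>n x y. (\<forall>i<n. y i = x i) \<longrightarrow> R n y = R n x" using 2 by blast
  ultimately show thesis using that[of R] 1 3 by blast
qed

section \<open>Capacitability and measurability for the completion\<close>

text \<open>Stage \<open>n\<close> of the dependent choice changes coordinate \<open>n\<close> only,
  so coordinate \<open>i\<close> is final from stage \<open>Suc i\<close> on. The diagonal therefore
  agrees with stage \<open>n\<close> below \<open>n\<close>, and \<open>cong\<close> transfers the
  property to it.\<close>

lemma coordinatewise_choice:
  fixes \<Phi> :: "nat \<Rightarrow> (nat \<Rightarrow> 'a) \<Rightarrow> bool"
  assumes "\<Phi> 0 x0" and "\<And>n x. \<Phi> n x \<Longrightarrow> \<exists>v. \<Phi> (Suc n) (x(n := v))"
    and cong: "\<And>n x y. (\<And>i. i < n \<Longrightarrow> x i = y i) \<Longrightarrow> \<Phi> n x \<Longrightarrow> \<Phi> n y"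
  obtains x where "\<And>n. \<Phi> n x"
proof -
  have "\<exists>f. \<forall>n. \<Phi> n (f n) \<and> (\<exists>v. f (Suc n) = (f n)(n := v))"
    by (rule dependent_nat_choice[of \<Phi> "\<lambda>n x y. \<exists>v. y = x(n := v)"]) (use assms(1,2) in blast)+
  then obtain f where f: "\<And>n. \<Phi> n (f n)" "\<And>n. \<exists>v. f (Suc n) = (f n)(n := v)" by blast
  have "f (n + k) i = f n i" if "i < n" for n k i
  proof (induction k)
    case (Suc k)
    then show ?case using f(2)[of "n + k"] that by auto
  qed simp
  from this[of _ "Suc _"] have "f n i = f (Suc i) i" if "i < n" for n i
    using that by (metis Suc_leI le_add_diff_inverse lessI)
  then have "\<Phi> n (\<lambda>i. f (Suc i) i)" for n
    by (rule cong[OF _ f(1)])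
  then show thesis by (rule that)
qed

text \<open>Koenig's lemma for the finitely branching tree of sequences below \<open>\<kappa>\<close>.\<close>

lemma bounded_branch:
  fixes R :: "nat \<Rightarrow> (nat \<Rightarrow> nat) \<Rightarrow> 'a set"
  assumes cong: "\<forall>n x y. (\<forall>i<n. y i = x i) \<longrightarrow> R n y = R n x"
    and dec: "\<And>n x. R (Suc n) x \<subseteq> R n x"
    and z: "\<And>n. \<exists>x. (\<forall>i<n. x i \<le> \<kappa> i) \<and> z \<in> R n x"
  shows "\<exists>x. \<forall>n. z \<in> R n x"
proof -
  have mono: "R N x \<subseteq> R n x" if "n \<le> N" for n N x
    using that by (induction rule: dec_induct) (use dec in blast)+
  \<comment> \<open>The prefix must stay extendable to every level; mere membership in
    \<open>R n x\<close> could lead to a dead end at the next coordinate.\<close>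
  define \<Phi> where "\<Phi> n x \<longleftrightarrow> (\<forall>N\<ge>n. \<exists>y. (\<forall>i<n. y i = x i) \<and> (\<forall>i<N. y i \<le> \<kappa> i) \<and> z \<in> R N y)" for n x
  have step: "\<exists>v. \<Phi> (Suc n) (x(n := v))" if "\<Phi> n x" for n x
  proof (rule ccontr)
    assume "\<not> ?thesis"
    then have "\<forall>v. \<exists>N\<ge>Suc n. \<forall>y. (\<forall>i<n. y i = x i) \<and> y n = v \<and> (\<forall>i<N. y i \<le> \<kappa> i) \<longrightarrow> z \<notin> R N y"
      unfolding \<Phi>_def by (simp add: less_Suc_eq) (smt (verit) fun_upd_apply less_irrefl)
    then obtain N where N: "\<And>v. N v \<ge> Suc n"
      "\<And>v y. (\<forall>i<n. y i = x i) \<Longrightarrow> y n = v \<Longrightarrow> (\<forall>i<N v. y i \<le> \<kappa> i) \<Longrightarrow> z \<notin> R (N v) y"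
      by metis
    \<comment> \<open>\<open>L\<close> dominates the failure levels of the finitely many values
      \<open>v \<le> \<kappa> n\<close>. A bounded extension to level \<open>L\<close> takes one of
      these values and, as the sets decrease, contradicts its failure level.\<close>
    define L where "L = Suc n + (\<Sum>v\<le>\<kappa> n. N v)"
    obtain y where y: "\<forall>i<n. y i = x i" "\<forall>i<L. y i \<le> \<kappa> i" "z \<in> R L y"
      using \<open>\<Phi> n x\<close> unfolding \<Phi>_def L_def by (metis le_add1 le_SucI add_Suc)
    have "y n \<le> \<kappa> n" using y(2) by (auto simp: L_def)
    then have "N (y n) \<le> L"
      using member_le_sum[of "y n" "{..\<kappa> n}" N] by (simp add: L_def)
    then show False using N(2)[of y "y n"] y mono[of "N (y n)" L y] by auto
  qed
  have "\<Phi> 0 (\<lambda>_. 0)" using z unfolding \<Phi>_def by simp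
  moreover have "\<Phi> n y" if "\<And>i. i < n \<Longrightarrow> x i = y i" "\<Phi> n x" for n x y
    using that unfolding \<Phi>_def by simp
  ultimately obtain x where x: "\<And>n. \<Phi> n x"
    using coordinatewise_choice[of \<Phi> "\<lambda>_. 0"] step by blast
  have "z \<in> R n x" for n
  proof -
    obtain y where "\<forall>i<n. y i = x i" "z \<in> R n y" using x[of n] unfolding \<Phi>_def by blast
    then show ?thesis using cong[rule_format, of n y x] by simp
  qed
  then show ?thesis by blast
qed

text \<open>Choquet's capacitability argument: outer measure is continuous along increasing
  sequences of arbitrary sets, so the coordinates can be bounded one after another while the outer
  measure stays above \<open>c\<close>. The bounded branches form a finitely branching tree, whose
  limit set is measurable and lies in \<open>A\<close>.\<close>

lemma suslin_inner_approximation: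
  fixes A :: "'a set"
  assumes "finite_measure P" "suslin (sets P) A" "c < outer_measure_of P A"
  obtains D where "D \<in> sets P" "D \<subseteq> A" "c \<le> emeasure P D"
proof -
  interpret finite_measure P by fact
  obtain R :: "nat \<Rightarrow> (nat \<Rightarrow> nat) \<Rightarrow> 'a set" where R: "\<And>n x. R n x \<in> sets P"
    and cong: "\<forall>n x y. (\<forall>i<n. y i = x i) \<longrightarrow> R n y = R n x"
    and dec: "\<And>n x. R (Suc n) x \<subseteq> R n x" and A: "A = (\<Union>x. \<Inter>n. R n x)"
    by (rule suslin_decreasing_scheme[OF assms(2) sets.top sets.sets_into_space sets.Int]) (assumption | rule that)+
  \<comment> \<open>Only the first \<open>n\<close> coordinates are bounded, so letting the bound on
    coordinate \<open>n\<close> grow exhausts \<open>F n k\<close>.\<close>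
  define F where "F n k = (\<Union>x\<in>{x. \<forall>i<n. x i \<le> k i}. \<Inter>m. R m x)" for n and k :: "nat \<Rightarrow> nat"
  have "c < outer_measure_of P (F 0 (\<lambda>_. 0))" using assms(3) by (simp add: F_def A)
  moreover have "\<exists>v. c < outer_measure_of P (F (Suc n) (k(n := v)))"
    if c: "c < outer_measure_of P (F n k)" for n k
  proof -
    have eq: "F n k = (\<Union>v. F (Suc n) (k(n := v)))"
    proof (intro equalityI subsetI)
      fix z assume "z \<in> F n k"
      then obtain x where "\<forall>i<n. x i \<le> k i" "\<forall>m. z \<in> R m x" by (auto simp: F_def)
      then have "z \<in> F (Suc n) (k(n := x n))" by (auto simp: F_def less_Suc_eq)
      then show "z \<in> (\<Union>v. F (Suc n) (k(n := v)))" by blast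
    next
      fix z assume "z \<in> (\<Union>v. F (Suc n) (k(n := v)))"
      then obtain v x where x: "\<forall>i<Suc n. x i \<le> (k(n := v)) i" "\<forall>m. z \<in> R m x" by (auto simp: F_def)
      then have "\<forall>i<n. x i \<le> k i" by (metis fun_upd_other less_SucI less_irrefl)
      then show "z \<in> F n k" using x(2) by (auto simp: F_def)
    qed
    have sp: "F n k \<subseteq> space P" for n k
      using sets.sets_into_space[OF R] unfolding F_def by blast
    have "incseq (\<lambda>v. F (Suc n) (k(n := v)))"
    proof (rule incseq_SucI)
      show "F (Suc n) (k(n := v)) \<subseteq> F (Suc n) (k(n := Suc v))" for v
        unfolding F_def by (intro UN_mono Collect_mono) (auto simp: less_Suc_eq)
    qed
    then have "(SUP v. outer_measure_of P (F (Suc n) (k(n := v)))) = outer_measure_of P (F n k)"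
      using SUP_outer_measure_of_incseq[of "\<lambda>v. F (Suc n) (k(n := v))" P] sp eq by simp
    then show ?thesis using c by (metis less_SUP_iff)
  qed
  moreover have "c < outer_measure_of P (F n y)"
    if "\<And>i. i < n \<Longrightarrow> x i = y i" "c < outer_measure_of P (F n x)" for n and x y :: "nat \<Rightarrow> nat"
  proof -
    have "F n x = F n y" using that(1) by (simp add: F_def)
    then show ?thesis using that(2) by simp
  qed
  ultimately obtain \<kappa> where \<kappa>: "\<And>n. c < outer_measure_of P (F n \<kappa>)"
    using coordinatewise_choice[of "\<lambda>n k. c < outer_measure_of P (F n k)" "\<lambda>_. 0"] by blast
  define D where "D n = (\<Union>x\<in>{x. \<forall>i<n. x i \<le> \<kappa> i}. R n x)" for n
  \<comment> \<open>Since \<open>R n\<close> reads only \<open>n\<close> coordinates, the union is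
    really finite, which makes \<open>D n\<close> measurable.\<close>
  have D_eq: "D n = (\<Union>x\<in>Pi\<^sub>E {..<n} (\<lambda>i. {..\<kappa> i}). R n x)" for n
  proof (intro equalityI subsetI)
    fix z assume "z \<in> D n"
    then obtain x where x: "\<forall>i<n. x i \<le> \<kappa> i" "z \<in> R n x" by (auto simp: D_def)
    then have "z \<in> R n (restrict x {..<n})" using cong[rule_format, of n "restrict x {..<n}" x] by simp
    then show "z \<in> (\<Union>x\<in>Pi\<^sub>E {..<n} (\<lambda>i. {..\<kappa> i}). R n x)" using x(1)
      by (intro UN_I[of "restrict x {..<n}"]) auto
  qed (auto simp: D_def PiE_iff)
  have Dm: "D n \<in> sets P" for n
    unfolding D_eq by (intro sets.finite_UN finite_PiE R) auto
  have "D (Suc n) \<subseteq> D n" for n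
    unfolding D_def by (rule UN_mono) (use dec in \<open>auto simp: less_Suc_eq\<close>)
  then have "decseq D" by (rule decseq_SucI)
  have "F n \<kappa> \<subseteq> D n" for n by (auto simp: F_def D_def)
  then have "c \<le> emeasure P (D n)" for n
    using outer_measure_of_mono[of "F n \<kappa>" "D n" P] \<kappa>[of n] Dm[of n] by simp
  then have "c \<le> (INF n. emeasure P (D n))" by (rule INF_greatest)
  moreover have "(INF n. emeasure P (D n)) = emeasure P (\<Inter>n. D n)"
    using Dm by (intro INF_emeasure_decseq' \<open>decseq D\<close>) auto
  ultimately have "c \<le> emeasure P (\<Inter>n. D n)" by simp
  moreover have "(\<Inter>n. D n) \<subseteq> A"
  proof
    fix z assume "z \<in> (\<Inter>n. D n)"
    then have "\<And>n. \<exists>x. (\<forall>i<n. x i \<le> \<kappa> i) \<and> z \<in> R n x" by (auto simp: D_def)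
    from bounded_branch[OF cong dec this] show "z \<in> A" by (auto simp: A)
  qed
  ultimately show thesis using Dm by (intro that[of "\<Inter>n. D n"]) auto
qed

text \<open>A countable union of measurable subsets of \<open>A\<close> exhausts its outer measure,
  which a measurable hull \<open>B\<close> attains; as \<open>P\<close> is finite, the gap between
  that union and \<open>B\<close> is null.\<close>

lemma suslin_sets_completion:
  fixes A :: "'a set"
  assumes P: "finite_measure P" and A: "suslin (sets P) A"
  shows "A \<in> sets (completion P)"
proof -
  interpret finite_measure P by fact
  have "A \<subseteq> space P"
  proof -
    obtain Q :: "nat \<Rightarrow> (nat \<Rightarrow> nat) \<Rightarrow> 'a set" where Q: "\<And>m x. Q m x \<in> sets P" "A = (\<Union>x. \<Inter>m. Q m x)"
      using A by (rule suslinE) (assumption | rule that)+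
    show ?thesis
    proof
      fix z assume "z \<in> A"
      then obtain x where "z \<in> Q 0 x" unfolding Q(2) by blast
      then show "z \<in> space P" using sets.sets_into_space[OF Q(1)[of 0 x]] by blast
    qed
  qed
  then obtain B where B: "B \<in> sets P" "A \<subseteq> B" "outer_measure_of P A = emeasure P B"
    using outer_measure_of_attain by metis
  define \<D> where "\<D> = {D \<in> sets P. D \<subseteq> A}"
  have "\<D> \<noteq> {}" by (auto simp: \<D>_def)
  then obtain f :: "nat \<Rightarrow> ennreal" where f: "range f \<subseteq> emeasure P ` \<D>" "(SUP D\<in>\<D>. emeasure P D) = (SUP i. f i)"
    using ennreal_Sup_countable_SUP[of "emeasure P ` \<D>"] by auto
  have "\<exists>D. D \<in> \<D> \<and> f i = emeasure P D" for i
    using range_subsetD[OF f(1), of i] by blast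
  then obtain D where D: "\<And>i. D i \<in> \<D>" "\<And>i. f i = emeasure P (D i)" by metis
  define D' where "D' = (\<Union>i. D i)"
  have D': "D' \<in> sets P" "D' \<subseteq> A" using D(1) by (auto simp: D'_def \<D>_def)
  have "emeasure P B \<le> emeasure P D'"
  proof (rule dense_le)
    fix c assume "c < emeasure P B"
    then have "c < outer_measure_of P A" using B(3) by simp
    then obtain C where "C \<in> \<D>" "c \<le> emeasure P C"
      by (rule suslin_inner_approximation[OF P A]) (simp add: \<D>_def that)
    then have "c \<le> (SUP i. f i)" unfolding f(2)[symmetric] by (intro SUP_upper2)
    also have "\<dots> \<le> emeasure P D'"
      unfolding D(2) by (intro SUP_least emeasure_mono D'(1)) (auto simp: D'_def)
    finally show "c \<le> emeasure P D'" .
  qed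
  moreover have "D' \<subseteq> B" using B(2) D'(2) by blast
  ultimately have "emeasure P (B - D') = 0"
    using emeasure_Diff[of P D' B] B(1) D'(1) by (simp add: diff_eq_0_iff_ennreal less_top[symmetric])
  then have "B - D' \<in> null_sets P" using B(1) D'(1) by auto
  moreover have "A = D' \<union> (A - D')" using D'(2) by blast
  moreover have "A - D' \<subseteq> B - D'" using B(2) by blast
  ultimately show ?thesis using sets_completionI D'(1) by blast
qed

section \<open>Projection along a compact factor\<close>

text \<open>Compact second factors make projection commute with decreasing intersections. The family
  is closed under finite intersections but not under complements, which have to be treated
  separately.\<close>

definition compact_rectangles :: "'a measure \<Rightarrow> 't::metric_space set \<Rightarrow> ('a \<times> 't) set set" where
  "compact_rectangles P K = {A \<times> C | A C. A \<in> sets P \<and> compact C \<and> C \<subseteq> K}"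

lemma compact_rectanglesI:
  "A \<in> sets P \<Longrightarrow> compact C \<Longrightarrow> C \<subseteq> K \<Longrightarrow> A \<times> C \<in> compact_rectangles P K"
  unfolding compact_rectangles_def by blast

text \<open>Along a fixed branch the fibres over a point are decreasing compact sets, so a point in
  the projections of all levels has one second coordinate common to them. Projecting level by level
  thus gives a scheme for the projection of \<open>E\<close>.\<close>

lemma suslin_projection:
  fixes K :: "'t::metric_space set" and P :: "'a measure"
  assumes K: "compact K" and E: "suslin (compact_rectangles P K) E"
  shows "suslin (sets P) (fst ` E)"
proof -
  obtain R :: "nat \<Rightarrow> (nat \<Rightarrow> nat) \<Rightarrow> ('a \<times> 't) set" where R: "\<And>n x. R n x \<in> compact_rectangles P K"
    and cong: "\<forall>n x y. (\<forall>i<n. y i = x i) \<longrightarrow> R n y = R n x"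
    and dec: "\<And>n x. R (Suc n) x \<subseteq> R n x" and E_eq: "E = (\<Union>x. \<Inter>n. R n x)"
  proof (rule suslin_decreasing_scheme[OF E, of "space P \<times> K"])
    show "space P \<times> K \<in> compact_rectangles P K" by (intro compact_rectanglesI K) auto
    show "A \<subseteq> space P \<times> K" if "A \<in> compact_rectangles P K" for A
      using that unfolding compact_rectangles_def by (auto dest: sets.sets_into_space)
    show "A \<inter> B \<in> compact_rectangles P K"
      if AB: "A \<in> compact_rectangles P K" "B \<in> compact_rectangles P K" for A B
    proof -
      obtain A1 A2 B1 B2 where "A = A1 \<times> A2" "B = B1 \<times> B2" "A1 \<in> sets P" "B1 \<in> sets P"
        "compact A2" "compact B2" "A2 \<subseteq> K" "B2 \<subseteq> K"
        using AB unfolding compact_rectangles_def by auto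
      then show ?thesis unfolding Times_Int_Times
        by (simp only: Times_Int_Times, intro compact_rectanglesI compact_Int) auto
    qed
  qed (assumption | rule that)+
  have mono: "R N x \<subseteq> R n x" if "n \<le> N" for n N x
    using that by (induction rule: dec_induct) (use dec in blast)+
  have "(\<Inter>n. fst ` R n x) \<subseteq> fst ` (\<Inter>n. R n x)" for x
  proof
    fix z assume z: "z \<in> (\<Inter>n. fst ` R n x)"
    define F where "F n = {t. (z, t) \<in> R n x}" for n
    have ne: "F n \<noteq> {}" for n
    proof -
      have "z \<in> fst ` R n x" using z by (rule INT_D) simp
      then show ?thesis by (auto simp: F_def)
    qed
    have comp: "compact (F n)" for n
    proof -
      obtain A C where "R n x = A \<times> C" "compact C" using R[of n x] unfolding compact_rectangles_def by blast
      then have "F n = C \<or> F n = {}" by (auto simp: F_def)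
      with \<open>compact C\<close> show ?thesis by auto
    qed
    have "F 0 \<inter> \<Inter> (range F) \<noteq> {}"
    proof (rule compact_imp_fip)
      show "compact (F 0)" by (rule comp)
      show "closed T" if "T \<in> range F" for T using that comp compact_imp_closed by auto
    next
      fix G assume "finite G" "G \<subseteq> range F"
      then obtain J where J: "finite J" "G = F ` J" by (meson finite_subset_image)
      \<comment> \<open>\<open>\<Sum>J\<close> serves as an upper bound of the finite set
        \<open>J\<close>.\<close>
      have F_mono: "F (\<Sum>J) \<subseteq> F i" if "i \<le> \<Sum>J" for i
        using mono[OF that, of x] unfolding F_def by blast
      have "i \<le> \<Sum>J" if "i \<in> J" for i
        using member_le_sum[OF that, of "\<lambda>i. i"] J(1) by simp
      then have "F (\<Sum>J) \<subseteq> F 0 \<inter> \<Inter> G" unfolding J(2) using F_mono by auto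
      then show "F 0 \<inter> \<Inter> G \<noteq> {}" using ne by blast
    qed
    then obtain t where t: "t \<in> \<Inter> (range F)" by blast
    have "(z, t) \<in> R n x" for n using INT_D[OF t, of n] by (simp add: F_def)
    then have "(z, t) \<in> (\<Inter>n. R n x)" by simp
    then show "z \<in> fst ` (\<Inter>n. R n x)" by (rule image_eqI[rotated]) simp
  qed
  moreover have "fst ` (\<Inter>n. R n x) \<subseteq> (\<Inter>n. fst ` R n x)" for x by (intro INT_greatest image_mono INT_lower) simp
  ultimately have "fst ` (\<Inter>n. R n x) = (\<Inter>n. fst ` R n x)" for x by (intro equalityI)
  then have "fst ` E = (\<Union>x. \<Inter>n. fst ` R n x)" unfolding E_eq image_UN by simp
  moreover have "fst ` R n x \<in> sets P" for n x
    using R[of n x] unfolding compact_rectangles_def by (auto simp: fst_image_times)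
  moreover have "\<exists>N. \<forall>y. (\<forall>i<N. y i = x i) \<longrightarrow> fst ` R n y = fst ` R n x" for n x
  proof (rule exI[of _ n], intro allI impI)
    fix y assume "\<forall>i<n. y i = x i"
    then have "R n y = R n x" by (rule cong[THEN spec, THEN spec, THEN spec, THEN mp])
    then show "fst ` R n y = fst ` R n x" by (rule arg_cong)
  qed
  ultimately show ?thesis
    unfolding suslin_def by (intro exI[of _ "\<lambda>n x. fst ` R n x"] conjI allI)
qed

lemma suslin_times_analytic:
  fixes K :: "'t::metric_space set" and P :: "'a measure"
  assumes K: "compact K" and T: "analytic_set T" "T \<subseteq> K"
  shows "suslin (compact_rectangles P K) (space P \<times> T)"
proof -
  obtain C :: "nat list \<Rightarrow> 't set" where C: "\<And>s. closed (C s)"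
    "T = (\<Union>x :: nat \<Rightarrow> nat. \<Inter>n. C (map x [0..<n]))"
    using T(1) unfolding analytic_set_def by blast
  define Q where "Q m x = space P \<times> (C (map x [0..<m]) \<inter> K)" for m and x :: "nat \<Rightarrow> nat"
  have "Q m x \<in> compact_rectangles P K" for m x
    unfolding Q_def using compact_Int_closed[OF K C(1)]
    by (intro compact_rectanglesI) (auto simp: Int_commute)
  moreover have "\<exists>N. \<forall>y. (\<forall>i<N. y i = x i) \<longrightarrow> Q m y = Q m x" for m x
  proof (rule exI[of _ m], intro allI impI)
    fix y assume "\<forall>i<m. y i = x i"
    then have "map y [0..<m] = map x [0..<m]" by simp
    then show "Q m y = Q m x" by (simp only: Q_def)
  qed
  moreover have "space P \<times> T = (\<Union>x. \<Inter>m. Q m x)"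
    using T(2) C(2) unfolding Q_def by blast
  ultimately show ?thesis unfolding suslin_def by (intro exI[of _ Q] conjI allI)
qed

text \<open>\<open>K - C\<close> is the countable union of the compact sets of points at distance at
  least \<open>1 / (n + 1)\<close> from \<open>C\<close>.\<close>

lemma suslin_compact_rectangles_Diff:
  fixes K C :: "'t::metric_space set" and P :: "'a measure"
  assumes K: "compact K" and C: "closed C"
  shows "suslin (compact_rectangles P K) (space P \<times> (K - C))"
proof -
  define D where "D n = {x \<in> K. \<forall>y\<in>C. inverse (real (Suc n)) \<le> dist x y}" for n
  have D: "D n = K \<inter> (\<Inter>y\<in>C. {x. inverse (real (Suc n)) \<le> dist x y})" for n
    by (auto simp: D_def)
  have "compact (D n)" for n
    unfolding D by (intro compact_Int_closed K closed_INT ballI closed_Collect_le continuous_intros)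
  then have "suslin (compact_rectangles P K) (space P \<times> D n)" for n
    by (intro suslin_member compact_rectanglesI) (auto simp: D_def)
  then have "suslin (compact_rectangles P K) (\<Union>n. space P \<times> D n)" by (rule suslin_Union)
  moreover have "(\<Union>n. space P \<times> D n) = space P \<times> (K - C)"
  proof -
    have "x \<in> (\<Union>n. D n)" if x: "x \<in> K" "x \<notin> C" for x
    proof -
      obtain e where "e > 0" "\<And>y. y \<in> C \<Longrightarrow> \<not> dist y x < e"
        using closed_approachable[OF C, of x] x(2) by blast
      moreover obtain n where "inverse (real (Suc n)) < e" using \<open>e > 0\<close> reals_Archimedean by blast
      ultimately have "x \<in> D n" using x(1) by (force simp: D_def dist_commute)
      then show ?thesis by blast
    qed
    moreover have "x \<notin> C" if "x \<in> D n" for x n using that by (force simp: D_def)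
    moreover have "D n \<subseteq> K" for n by (simp add: D_def)
    ultimately have "(\<Union>n. D n) = K - C" by blast
    moreover have "(\<Union>n. space P \<times> D n) = space P \<times> (\<Union>n. D n)" by blast
    ultimately show ?thesis by simp
  qed
  ultimately show ?thesis by simp
qed

text \<open>Suslin sets need not be closed under complements, so the sigma-algebra consists of the
  sets that are Suslin together with their complement. Both coordinate maps are measurable for it,
  hence so is the identity into the product.\<close>

lemma suslin_pair_borel:
  fixes K :: "'t::metric_space set" and P :: "'a measure"
  assumes K: "compact K" and E: "E \<in> sets (P \<Otimes>\<^sub>M borel)"
  shows "suslin (compact_rectangles P K) (E \<inter> (space P \<times> K))"
proof -
  let ?S = "suslin (compact_rectangles P K)" and ?\<Omega> = "space P \<times> K"
  define \<D> where "\<D> = {E. E \<subseteq> ?\<Omega> \<and> ?S E \<and> ?S (?\<Omega> - E)}"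
  have \<Omega>: "?S ?\<Omega>" by (intro suslin_member compact_rectanglesI K) auto
  have empty: "?S {}" using suslin_member[OF compact_rectanglesI[of "{}" P K K]] K by simp
  have "sigma_algebra ?\<Omega> \<D>"
    unfolding sigma_algebra_iff2
  proof (intro conjI ballI allI impI)
    fix A :: "nat \<Rightarrow> ('a \<times> 't) set" assume A: "range A \<subseteq> \<D>"
    have "?\<Omega> - (\<Union>i. A i) = (\<Inter>i. ?\<Omega> - A i)" by auto
    then show "(\<Union>i. A i) \<in> \<D>"
      using A suslin_Union[of "compact_rectangles P K" A]
        suslin_Inter[of "compact_rectangles P K" "\<lambda>i. ?\<Omega> - A i"]
      unfolding \<D>_def by (auto simp: image_subset_iff)
  qed (auto simp: \<D>_def \<Omega> empty double_diff)
  then interpret sigma_algebra ?\<Omega> \<D> .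
  define N where "N = sigma ?\<Omega> \<D>"
  have N: "space N = ?\<Omega>" "sets N = \<D>"
    using space_closed by (auto simp: N_def sigma_sets_eq)
  have "fst \<in> measurable N P"
  proof (rule measurableI)
    fix A assume A: "A \<in> sets P"
    have "fst -` A \<inter> space N = A \<times> K" "?\<Omega> - A \<times> K = (space P - A) \<times> K"
      using sets.sets_into_space[OF A] by (auto simp: N)
    then show "fst -` A \<inter> space N \<in> sets N"
      using A sets.sets_into_space[OF A] unfolding N \<D>_def
      by (auto intro!: suslin_member compact_rectanglesI K)
  qed (auto simp: N)
  moreover have "snd \<in> measurable N borel"
  proof (rule borel_measurableI)
    fix S :: "'t set" assume S: "open S"
    then have cl: "closed (- S)" by (rule closed_Compl)
    have "?\<Omega> - space P \<times> (K - (- S)) = space P \<times> (K \<inter> (- S))" by auto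
    moreover have "?S (space P \<times> (K \<inter> (- S)))"
      by (intro suslin_member compact_rectanglesI compact_Int_closed K cl) auto
    ultimately have "space P \<times> (K - (- S)) \<in> \<D>"
      using suslin_compact_rectangles_Diff[OF K cl, of P] unfolding \<D>_def by auto
    moreover have "snd -` S \<inter> space N = space P \<times> (K - (- S))" by (auto simp: N)
    ultimately show "snd -` S \<inter> space N \<in> sets N" by (simp add: N)
  qed
  ultimately have "(\<lambda>z. z) \<in> measurable N (P \<Otimes>\<^sub>M borel)"
    by (simp add: measurable_pair_iff comp_def)
  from measurable_sets[OF this E] have "E \<inter> ?\<Omega> \<in> \<D>" by (simp add: N)
  then show ?thesis by (simp add: \<D>_def)
qed

text \<open>\<open>T\<close> need not be Borel. Hence \<open>E\<close> is extended to a
  product-measurable \<open>E0\<close> on the whole space and then cut with the Suslin set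
  \<open>space P \<times> T\<close>.\<close>

theorem measurable_projection:
  fixes K T :: "'t::metric_space set" and P :: "'a measure"
  assumes P: "finite_measure P" and K: "compact K" and T: "analytic_set T" "T \<subseteq> K"
    and E: "E \<in> sets (P \<Otimes>\<^sub>M restrict_space borel T)"
  shows "fst ` E \<in> sets (completion P)"
proof -
  let ?N = "restrict_space (P \<Otimes>\<^sub>M (borel :: 't measure)) (space P \<times> T)"
  have E_sub: "E \<subseteq> space P \<times> T"
    using sets.sets_into_space[OF E] by (simp add: space_pair_measure space_restrict_space)
  have sp: "space ?N = space P \<times> T" by (auto simp: space_restrict_space space_pair_measure)
  have "fst \<in> measurable ?N P" by (intro measurable_restrict_space1) simp
  moreover have "snd \<in> measurable ?N (restrict_space borel T)"
    by (intro measurable_restrict_space2 measurable_restrict_space1) (auto simp: sp)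
  ultimately have "(\<lambda>z. z) \<in> measurable ?N (P \<Otimes>\<^sub>M restrict_space borel T)"
    by (simp add: measurable_pair_iff comp_def)
  from measurable_sets[OF this E] have "E \<in> sets ?N" using E_sub by (simp add: sp Int_absorb2)
  then obtain E0 where E0: "E0 \<in> sets (P \<Otimes>\<^sub>M (borel :: 't measure))" "E = E0 \<inter> (space P \<times> T)"
    by (auto simp: sets_restrict_space)
  have "E = (E0 \<inter> (space P \<times> K)) \<inter> (space P \<times> T)" using E0(2) T(2) by auto
  then have "suslin (compact_rectangles P K) E"
    using suslin_Int[OF suslin_pair_borel[OF K E0(1)] suslin_times_analytic[OF K T]] by simp
  then show ?thesis
    using suslin_sets_completion[OF P suslin_projection[OF K]] by blast
qed

section \<open>Shattering and sign sums\<close>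

lemma VC_class_bound:
  assumes "VC_class \<C>"
  obtains d where "\<And>A. finite A \<Longrightarrow> shatters \<C> A \<Longrightarrow> card A \<le> d"
proof -
  obtain d where d: "vc_dim \<C> = enat d" using assms unfolding VC_class_def by auto
  have "card A \<le> d" if "finite A" "shatters \<C> A" for A
  proof -
    have "enat (card A) \<le> vc_dim \<C>"
      unfolding vc_dim_def using that by (intro SUP_upper) simp
    then show ?thesis using d by simp
  qed
  then show thesis by (rule that)
qed

text \<open>Pajor's form of the Sauer--Shelah lemma.\<close>

lemma card_le_card_shattered:
  assumes "finite S" "F \<subseteq> Pow S"
  shows "card F \<le> card {A. A \<subseteq> S \<and> shatters F A}"
  using assms
proof (induction S arbitrary: F rule: finite_induct)
  case empty
  then have "F = {} \<or> F = {{}}" by auto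
  then show ?case
  proof
    assume F: "F = {{}}"
    have "{A. A \<subseteq> {} \<and> shatters F A} = {{}}" by (auto simp: F shatters_def)
    then show ?thesis by (simp add: F)
  qed simp
next
  case (insert x S)
  \<comment> \<open>Deleting \<open>x\<close> can merge members of \<open>F\<close> that differ only
    in \<open>x\<close>; keeping the two halves apart preserves the count.\<close>
  define F0 F1 where "F0 = {C \<in> F. x \<notin> C}" and "F1 = (\<lambda>C. C - {x}) ` {C \<in> F. x \<in> C}"
  define Z where "Z G = {A. A \<subseteq> S \<and> shatters G A}" for G
  have fin: "finite F" using insert.prems insert.hyps(1) by (meson finite_Pow_iff finite_insert finite_subset)
  have finZ: "finite (Z G)" for G using insert.hyps(1) by (auto simp: Z_def)
  have "inj_on (\<lambda>C. C - {x}) {C \<in> F. x \<in> C}" by (auto simp: inj_on_def)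
  then have "card F1 = card {C \<in> F. x \<in> C}" unfolding F1_def by (rule card_image)
  moreover have "card F = card F0 + card {C \<in> F. x \<in> C}"
    unfolding F0_def using fin by (subst card_Un_disjoint[symmetric]) (auto intro!: arg_cong[where f=card])
  ultimately have "card F = card F0 + card F1" by simp
  also have "\<dots> \<le> card (Z F0) + card (Z F1)"
    unfolding Z_def using insert.prems by (intro add_mono insert.IH) (auto simp: F0_def F1_def)
  \<comment> \<open>A set \<open>A\<close> shattered by both halves is counted twice; the second
    count is charged to \<open>insert x A\<close>, which \<open>F\<close> then shatters.\<close>
  also have "\<dots> = card (Z F0 \<union> Z F1) + card (Z F0 \<inter> Z F1)"
    by (rule card_Un_Int[OF finZ finZ])
  also have "card (Z F0 \<inter> Z F1) = card (insert x ` (Z F0 \<inter> Z F1))"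
    using insert.hyps(2) by (intro card_image[symmetric] inj_onI) (auto simp: Z_def)
  also have "card (Z F0 \<union> Z F1) + card (insert x ` (Z F0 \<inter> Z F1)) =
      card ((Z F0 \<union> Z F1) \<union> insert x ` (Z F0 \<inter> Z F1))"
    using insert.hyps(2) finZ by (intro card_Un_disjoint[symmetric]) (auto simp: Z_def)
  also have "\<dots> \<le> card {A. A \<subseteq> insert x S \<and> shatters F A}"
  proof (rule card_mono)
    show "finite {A. A \<subseteq> insert x S \<and> shatters F A}" using insert.hyps(1) by auto
    have "shatters F A" if A: "A \<in> Z F0" for A
      using A unfolding Z_def shatters_def F0_def by blast
    moreover have "shatters F A" if A: "A \<in> Z F1" for A
      unfolding shatters_def
    proof (intro allI impI)
      fix D assume "D \<subseteq> A"
      then obtain C where "C \<in> F" "(C - {x}) \<inter> A = D"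
        using A unfolding Z_def shatters_def F1_def by blast
      moreover have "x \<notin> A" using A insert.hyps(2) by (auto simp: Z_def)
      ultimately show "\<exists>C\<in>F. C \<inter> A = D" by (intro bexI[of _ C]) auto
    qed
    moreover have "shatters F (insert x A)" if A: "A \<in> Z F0" "A \<in> Z F1" for A
      unfolding shatters_def
    proof (intro allI impI)
      fix D assume D: "D \<subseteq> insert x A"
      have x: "x \<notin> A" using A insert.hyps(2) by (auto simp: Z_def)
      have D': "D - {x} \<subseteq> A" using D by blast
      show "\<exists>C\<in>F. C \<inter> insert x A = D"
      proof (cases "x \<in> D")
        case True
        obtain C where "C \<in> F" "x \<in> C" "(C - {x}) \<inter> A = D - {x}"
          using A(2) D' unfolding Z_def shatters_def F1_def by blast
        then show ?thesis using True x by (intro bexI[of _ C]) auto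
      next
        case False
        obtain C where "C \<in> F" "x \<notin> C" "C \<inter> A = D - {x}"
          using A(1) D' unfolding Z_def shatters_def F0_def by blast
        then show ?thesis using False x by (intro bexI[of _ C]) auto
      qed
    qed
    ultimately show "Z F0 \<union> Z F1 \<union> insert x ` (Z F0 \<inter> Z F1) \<subseteq> {A. A \<subseteq> insert x S \<and> shatters F A}"
      by (auto simp: Z_def)
  qed
  finally show ?case .
qed

text \<open>A nonempty set of at most \<open>Suc d\<close> elements arises from one of at most
  \<open>d\<close> by adding a point, the empty set by adding none (\<open>None\<close>):
  \<open>card S + 1\<close> choices per step.\<close>

lemma card_subsets_le_power:
  assumes "finite S"
  shows "card {A. A \<subseteq> S \<and> card A \<le> d} \<le> (card S + 1) ^ d"
proof (induction d)
  case 0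
  have "{A. A \<subseteq> S \<and> card A \<le> 0} = {{}}" using assms by (auto dest: finite_subset)
  then show ?case by simp
next
  case (Suc d)
  let ?P = "\<lambda>d. {A. A \<subseteq> S \<and> card A \<le> d}"
  let ?g = "\<lambda>(A, z). case z of None \<Rightarrow> A | Some x \<Rightarrow> insert x A"
  have fin: "finite (?P d \<times> insert None (Some ` S))" using assms by auto
  have "?P (Suc d) \<subseteq> ?g ` (?P d \<times> insert None (Some ` S))"
  proof
    fix A assume A: "A \<in> ?P (Suc d)"
    show "A \<in> ?g ` (?P d \<times> insert None (Some ` S))"
    proof (cases "A = {}")
      case True
      then show ?thesis by (intro image_eqI[of _ _ "({}, None)"]) auto
    next
      case False
      then obtain x where x: "x \<in> A" by blast
      have "finite A" using A assms finite_subset by auto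
      then have "card (A - {x}) \<le> d" using A x by auto
      then show ?thesis using A x
        by (intro image_eqI[of _ _ "(A - {x}, Some x)"]) auto
    qed
  qed
  then have "card (?P (Suc d)) \<le> card (?P d \<times> insert None (Some ` S))"
    using fin by (rule surj_card_le[rotated])
  also have "\<dots> = card (?P d) * (card S + 1)"
    using assms by (simp add: card_cartesian_product card_image)
  also have "\<dots> \<le> (card S + 1) ^ d * (card S + 1)" using Suc.IH by (rule mult_right_mono) simp
  finally show ?case by (simp add: mult.commute)
qed

text \<open>A subset of \<open>S\<close> shattered by the traces is shattered by \<open>\<C>\<close>
  itself, hence has at most \<open>d\<close> elements.\<close>

lemma card_traces_le:
  assumes d: "\<And>A. finite A \<Longrightarrow> shatters \<C> A \<Longrightarrow> card A \<le> d" and S: "finite S"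
  shows "card ((\<lambda>C. C \<inter> S) ` \<C>) \<le> (card S + 1) ^ d"
proof -
  let ?F = "(\<lambda>C. C \<inter> S) ` \<C>"
  have "card ?F \<le> card {A. A \<subseteq> S \<and> shatters ?F A}"
    by (rule card_le_card_shattered[OF S]) auto
  also have "\<dots> \<le> card {A. A \<subseteq> S \<and> card A \<le> d}"
  proof (rule card_mono)
    show "finite {A. A \<subseteq> S \<and> card A \<le> d}" using S by simp
    show "{A. A \<subseteq> S \<and> shatters ?F A} \<subseteq> {A. A \<subseteq> S \<and> card A \<le> d}"
    proof safe
      fix A assume A: "A \<subseteq> S" "shatters ?F A"
      have "\<exists>C\<in>\<C>. C \<inter> A = D" if D: "D \<subseteq> A" for D
      proof -
        obtain C where "C \<in> \<C>" "C \<inter> S \<inter> A = D" using A(2)[unfolded shatters_def, rule_format, OF D] by auto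
        moreover have "C \<inter> S \<inter> A = C \<inter> A" using A(1) by blast
        ultimately show ?thesis by auto
      qed
      then have "shatters \<C> A" unfolding shatters_def by blast
      then show "card A \<le> d" using d finite_subset[OF A(1) S] by blast
    qed
  qed
  also have "\<dots> \<le> (card S + 1) ^ d" by (rule card_subsets_le_power[OF S])
  finally show ?thesis .
qed

section \<open>Hoeffding's bound for random signs\<close>

lemma two_power_fact_le_fact_double: "2 ^ k * fact k \<le> (fact (2 * k) :: real)"
proof (induction k)
  case (Suc k)
  have "(2::real) ^ Suc k * fact (Suc k) = (2 * (real k + 1)) * (2 ^ k * fact k)" by simp
  also have "\<dots> \<le> (2 * (real k + 1)) * fact (2 * k)" using Suc by (intro mult_left_mono) auto
  also have "\<dots> \<le> (2 * real k + 1) * ((2 * (real k + 1)) * fact (2 * k))"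
  proof -
    have "1 * ((2 * (real k + 1)) * fact (2 * k)) \<le> (2 * real k + 1) * ((2 * (real k + 1)) * fact (2 * k))"
      by (rule mult_right_mono) auto
    then show ?thesis by simp
  qed
  also have "\<dots> = fact (2 * Suc k)" by (simp add: algebra_simps)
  finally show ?case .
qed simp

text \<open>Termwise comparison of the Taylor series, the odd terms of \<open>cosh\<close> being
  zero.\<close>

lemma cosh_le_exp_square: "cosh (x::real) \<le> exp (x\<^sup>2 / 2)"
proof (rule sums_le)
  have "(\<lambda>k. if even (2 * k) then x ^ (2 * k) /\<^sub>R fact (2 * k) else 0) sums cosh x"
    using cosh_converges[of x]
    by (subst sums_mono_reindex[of "\<lambda>k. 2 * k" "\<lambda>n. if even n then x ^ n /\<^sub>R fact n else 0"])
       (auto simp: strict_mono_def)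
  then show "(\<lambda>k. x ^ (2 * k) /\<^sub>R fact (2 * k)) sums cosh x" by simp
  show "(\<lambda>k. (x\<^sup>2 / 2) ^ k /\<^sub>R fact k) sums exp (x\<^sup>2 / 2)" by (rule exp_converges)
  show "x ^ (2 * k) /\<^sub>R fact (2 * k) \<le> (x\<^sup>2 / 2) ^ k /\<^sub>R fact k" for k
  proof -
    have "x ^ (2 * k) / fact (2 * k) \<le> x ^ (2 * k) / (2 ^ k * fact k)"
      by (intro divide_left_mono two_power_fact_le_fact_double) (auto simp: power_mult)
    moreover have "x ^ (2 * k) /\<^sub>R fact (2 * k) = x ^ (2 * k) / fact (2 * k)"
      by (simp only: real_scaleR_def divide_inverse mult.commute)
    moreover have "(x\<^sup>2 / 2) ^ k /\<^sub>R fact k = x ^ (2 * k) / (2 ^ k * fact k)"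
    proof -
      have "inverse c * (a / b) = a / (b * c)" for a b c :: real
        by (simp add: divide_inverse)
      then show ?thesis by (simp only: real_scaleR_def power_divide power_mult)
    qed
    ultimately show ?thesis by (simp only:)
  qed
qed

text \<open>Chernoff's method in counting form: \<open>s\<close> collects the indices with a flipped
  sign, and the exponential moment summed over \<open>Pow I\<close> factorizes into terms
  \<open>2 * cosh (l * a i)\<close>.\<close>

lemma sign_sum_upper_tail:
  fixes a :: "'i \<Rightarrow> real" and n :: real
  assumes I: "finite I" "real (card I) \<le> n" "0 < n" and a: "\<And>i. i \<in> I \<Longrightarrow> \<bar>a i\<bar> \<le> 1" and t: "0 \<le> t"
  shows "real (card {s \<in> Pow I. t \<le> (\<Sum>i\<in>I. if i \<in> s then - a i else a i)})
    \<le> 2 ^ card I * exp (- t\<^sup>2 / (2 * n))"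
proof -
  \<comment> \<open>The minimizer of the exponent \<open>n * l\<^sup>2 / 2 - l * t\<close>.\<close>
  define l where "l = t / n"
  define S where "S s = (\<Sum>i\<in>I. if i \<in> s then - a i else a i)" for s
  let ?A = "{s \<in> Pow I. t \<le> S s}"
  have l: "0 \<le> l" using t I by (simp add: l_def)
  have "real (card ?A) * exp (l * t) = (\<Sum>s\<in>?A. exp (l * t))" by simp
  also have "\<dots> \<le> (\<Sum>s\<in>?A. exp (l * S s))"
    using l by (intro sum_mono) (auto intro: mult_left_mono)
  also have "\<dots> \<le> (\<Sum>s\<in>Pow I. exp (l * S s))"
    using I by (intro sum_mono2) auto
  also have "\<dots> = (\<Sum>s\<in>Pow I. (\<Prod>i\<in>s. exp (- l * a i)) * (\<Prod>i\<in>I - s. exp (l * a i)))"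
  proof (rule sum.cong[OF refl])
    fix s assume s: "s \<in> Pow I"
    have "exp (l * S s) = (\<Prod>i\<in>I. if i \<in> s then exp (- l * a i) else exp (l * a i))"
      unfolding S_def sum_distrib_left exp_sum[OF I(1)] by (intro prod.cong) auto
    also have "\<dots> = (\<Prod>i\<in>s. exp (- l * a i)) * (\<Prod>i\<in>I - s. exp (l * a i))"
      using s I by (subst prod.If_cases) (auto simp: Int_absorb1 Diff_eq)
    finally show "exp (l * S s) = (\<Prod>i\<in>s. exp (- l * a i)) * (\<Prod>i\<in>I - s. exp (l * a i))" .
  qed
  also have "\<dots> = (\<Prod>i\<in>I. exp (- l * a i) + exp (l * a i))"
    by (rule prod_add[OF I(1), symmetric])
  also have "\<dots> \<le> (\<Prod>i\<in>I. 2 * exp (l\<^sup>2 / 2))"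
  proof (rule prod_mono)
    fix i assume i: "i \<in> I"
    have "exp (- l * a i) + exp (l * a i) = 2 * cosh (l * a i)" by (simp add: cosh_def)
    also have "\<dots> \<le> 2 * exp ((l * a i)\<^sup>2 / 2)" using cosh_le_exp_square by simp
    also have "\<dots> \<le> 2 * exp (l\<^sup>2 / 2)"
    proof -
      have "(a i)\<^sup>2 \<le> 1" using a[OF i] by (simp add: abs_square_le_1)
      then have "l\<^sup>2 * (a i)\<^sup>2 \<le> l\<^sup>2" by (simp add: mult_left_le)
      then show ?thesis by (simp add: power_mult_distrib)
    qed
    finally show "0 \<le> exp (- l * a i) + exp (l * a i) \<and> exp (- l * a i) + exp (l * a i) \<le> 2 * exp (l\<^sup>2 / 2)"
      by (simp add: add_nonneg_nonneg)
  qed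
  also have "\<dots> = 2 ^ card I * exp (real (card I) * (l\<^sup>2 / 2))"
    by (simp add: power_mult_distrib exp_of_nat_mult[symmetric])
  also have "\<dots> \<le> 2 ^ card I * exp (n * (l\<^sup>2 / 2))"
    using I by (intro mult_left_mono) (auto intro: mult_right_mono)
  finally have "real (card ?A) * exp (l * t) \<le> 2 ^ card I * exp (n * (l\<^sup>2 / 2))" .
  then have "real (card ?A) \<le> 2 ^ card I * exp (n * (l\<^sup>2 / 2)) / exp (l * t)"
    by (simp add: pos_le_divide_eq)
  also have "\<dots> = 2 ^ card I * exp (n * (l\<^sup>2 / 2) - l * t)" by (simp add: exp_diff)
  also have "n * (l\<^sup>2 / 2) - l * t = - t\<^sup>2 / (2 * n)"
    using I(3) by (simp add: l_def power2_eq_square field_simps)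
  finally show ?thesis unfolding S_def .
qed

lemma sign_sum_tail:
  fixes a :: "'i \<Rightarrow> real" and n :: real
  assumes I: "finite I" "real (card I) \<le> n" "0 < n" and a: "\<And>i. i \<in> I \<Longrightarrow> \<bar>a i\<bar> \<le> 1" and t: "0 \<le> t"
  shows "real (card {s \<in> Pow I. t \<le> \<bar>\<Sum>i\<in>I. if i \<in> s then - a i else a i\<bar>})
    \<le> 2 * 2 ^ card I * exp (- t\<^sup>2 / (2 * n))"
proof -
  let ?A = "\<lambda>a. {s \<in> Pow I. t \<le> (\<Sum>i\<in>I. if i \<in> s then - a i else a i)}"
  have "(\<Sum>i\<in>I. if i \<in> s then - (- a i) else - a i) = - (\<Sum>i\<in>I. if i \<in> s then - a i else a i)" for s
    unfolding sum_negf[symmetric] by (intro sum.cong) auto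
  then have "{s \<in> Pow I. t \<le> \<bar>\<Sum>i\<in>I. if i \<in> s then - a i else a i\<bar>} \<subseteq> ?A a \<union> ?A (\<lambda>i. - a i)"
    by auto
  then have "card {s \<in> Pow I. t \<le> \<bar>\<Sum>i\<in>I. if i \<in> s then - a i else a i\<bar>} \<le> card (?A a \<union> ?A (\<lambda>i. - a i))"
    using I(1) by (intro card_mono) auto
  also have "\<dots> \<le> card (?A a) + card (?A (\<lambda>i. - a i))" by (rule card_Un_le)
  finally have "real (card {s \<in> Pow I. t \<le> \<bar>\<Sum>i\<in>I. if i \<in> s then - a i else a i\<bar>})
      \<le> real (card (?A a)) + real (card (?A (\<lambda>i. - a i)))" by linarith
  moreover have "real (card (?A a)) \<le> 2 ^ card I * exp (- t\<^sup>2 / (2 * n))"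
    by (rule sign_sum_upper_tail) (use I a t in auto)
  moreover have "real (card (?A (\<lambda>i. - a i))) \<le> 2 ^ card I * exp (- t\<^sup>2 / (2 * n))"
    by (rule sign_sum_upper_tail) (use I a t in auto)
  ultimately show ?thesis by linarith
qed

section \<open>Uniform deviations over a VC class\<close>

abbreviation iid_sample :: "'i set \<Rightarrow> 'u measure \<Rightarrow> ('i \<Rightarrow> 'u) measure" where
  "iid_sample I \<nu> \<equiv> Pi\<^sub>M I (\<lambda>_. \<nu>)"

text \<open>Shows that a ghost sample is close to its mean often enough:
  \<open>4 * n \<le> t\<^sup>2\<close> makes Hoeffding's exponent at most \<open>- 2\<close>, and
  \<open>2 * exp (- 2) \<le> 1 / 2\<close>.\<close>

lemma coordinates_sum_concentration:
  fixes I :: "'i set" and \<nu> :: "'u measure" and n t :: real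
  assumes \<nu>: "prob_space \<nu>" and I: "finite I" "real (card I) \<le> n" and t: "0 < t" "4 * n \<le> t\<^sup>2"
    and W: "W \<in> sets \<nu>"
  shows "1 / 2 \<le> measure (iid_sample I \<nu>) {z \<in> space (iid_sample I \<nu>).
    \<bar>(\<Sum>i\<in>I. indicator W (z i)) - real (card I) * measure \<nu> W\<bar> < t / 2}"
proof -
  let ?P = "iid_sample I \<nu>"
  interpret \<nu>: prob_space \<nu> by fact
  interpret P: prob_space ?P by (intro prob_space_PiM \<nu>)
  define X :: "'i \<Rightarrow> ('i \<Rightarrow> 'u) \<Rightarrow> real" where "X i z = indicator W (z i)" for i z
  have X_meas [measurable]: "X i \<in> borel_measurable ?P" if "i \<in> I" for i
    using that W unfolding X_def by measurable
  have expect: "P.expectation (X i) = measure \<nu> W" if i: "i \<in> I" for i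
  proof -
    have "P.expectation (X i) = (\<integral>u. indicator W u \<partial>distr ?P \<nu> (\<lambda>z. z i))"
      unfolding X_def using i W by (intro integral_distr[symmetric]) auto
    also have "distr ?P \<nu> (\<lambda>z. z i) = \<nu>"
      using distr_PiM_component[of I "\<lambda>_. \<nu>" i] I(1) \<nu> i by simp
    finally show ?thesis using W sets.sets_into_space[OF W] by (simp add: Int_absorb2)
  qed
  let ?S = "\<lambda>z. \<Sum>i\<in>I. X i z"
  show ?thesis
  proof (cases "I = {}")
    case True
    then show ?thesis using t(1) P.prob_space by simp
  next
    case False
    then have card: "real (card I) > 0" using I(1) by (simp add: card_gt_0_iff)
    have "P.indep_vars (\<lambda>_. \<nu>) (\<lambda>i z. z i) I"
    proof (subst P.indep_vars_iff_distr_eq_PiM'[OF False])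
      have "distr ?P ?P (\<lambda>z. \<lambda>i\<in>I. z i) = distr ?P ?P (\<lambda>z. z)"
        by (intro distr_cong) (auto simp: space_PiM PiE_restrict)
      also have "\<dots> = ?P" by (rule distr_id)
      also have "\<dots> = Pi\<^sub>M I (\<lambda>i. distr ?P \<nu> (\<lambda>z. z i))"
        using distr_PiM_component[of I "\<lambda>_. \<nu>"] I(1) \<nu> by (intro PiM_cong) simp_all
      finally show "distr ?P ?P (\<lambda>z. \<lambda>i\<in>I. z i) = Pi\<^sub>M I (\<lambda>i. distr ?P \<nu> (\<lambda>z. z i))" .
    qed auto
    then have "P.indep_vars (\<lambda>_. borel) X I"
      unfolding X_def using W by (intro P.indep_vars_compose2[of "\<lambda>_. \<nu>" "\<lambda>i z. z i" I "\<lambda>_. indicator W"]) auto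
    then interpret Hoeffding_ineq ?P I X "\<lambda>_. 0" "\<lambda>_. 1" "\<Sum>i\<in>I. P.expectation (X i)"
      by unfold_locales (use I(1) in \<open>auto simp: X_def indicator_def\<close>)
    have E: "(\<Sum>i\<in>I. P.expectation (X i)) = real (card I) * measure \<nu> W"
      using expect by simp
    have "P.prob {z \<in> space ?P. t / 2 \<le> \<bar>?S z - real (card I) * measure \<nu> W\<bar>} \<le>
        2 * exp (- 2 * (t / 2)\<^sup>2 / real (card I))"
      using Hoeffding_ineq_abs_ge[of "t / 2"] card t(1) unfolding E by simp
    also have "\<dots> \<le> 2 * exp (- 2)"
    proof -
      have "2 * real (card I) \<le> 2 * (t / 2)\<^sup>2" using I(2) t(2) by (simp add: power_divide)
      then have "2 \<le> 2 * (t / 2)\<^sup>2 / real (card I)" using card by (simp add: pos_le_divide_eq)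
      then show ?thesis by simp
    qed
    also have "\<dots> \<le> 1 / 2"
    proof -
      have "(2::real) * 2 \<le> exp 1 * exp 1"
        using exp_ge_add_one_self[of 1] by (intro mult_mono) auto
      then have "4 \<le> exp (2::real)" by (simp add: exp_add[symmetric])
      then show ?thesis by (simp add: exp_minus field_simps)
    qed
    finally have "P.prob {z \<in> space ?P. t / 2 \<le> \<bar>?S z - real (card I) * measure \<nu> W\<bar>} \<le> 1 / 2" .
    moreover have "P.prob {z \<in> space ?P. \<bar>?S z - real (card I) * measure \<nu> W\<bar> < t / 2} =
        1 - P.prob {z \<in> space ?P. t / 2 \<le> \<bar>?S z - real (card I) * measure \<nu> W\<bar>}"
      by (subst P.prob_neg[symmetric]) (auto simp: not_le)
    ultimately show ?thesis unfolding X_def by simp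
  qed
qed

section \<open>The ghost sample\<close>

text \<open>Merges the sample (tag \<open>True\<close>) and its ghost (tag \<open>False\<close>)
  into one family, so that exchanging them becomes a permutation of the coordinates of a single
  product measure.\<close>

definition pair_sample :: "'i set \<Rightarrow> ('i \<Rightarrow> 'u) \<times> ('i \<Rightarrow> 'u) \<Rightarrow> 'i \<times> bool \<Rightarrow> 'u" where
  "pair_sample I z = (\<lambda>j\<in>I \<times> UNIV. if snd j then fst z (fst j) else snd z (fst j))"

lemma measurable_pair_sample:
  fixes I :: "'i set"
  shows
  "pair_sample I \<in> measurable (iid_sample I \<nu> \<Otimes>\<^sub>M iid_sample I \<nu>) (iid_sample (I \<times> UNIV) \<nu>)"
  unfolding pair_sample_def
proof (rule measurable_restrict)
  fix j :: "'i \<times> bool" assume "j \<in> I \<times> UNIV"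
  then have "fst j \<in> I" by auto
  then show "(\<lambda>z. if snd j then fst z (fst j) else snd z (fst j))
      \<in> measurable (iid_sample I \<nu> \<Otimes>\<^sub>M iid_sample I \<nu>) \<nu>"
    by (cases "snd j") simp_all
qed

lemma distr_pair_sample:
  fixes I :: "'i set" and \<nu> :: "'u measure"
  assumes \<nu>: "prob_space \<nu>" and I: "finite I"
  shows "distr (iid_sample I \<nu> \<Otimes>\<^sub>M iid_sample I \<nu>) (iid_sample (I \<times> UNIV) \<nu>) (pair_sample I) =
    iid_sample (I \<times> UNIV) \<nu>"
proof -
  interpret \<nu>: prob_space \<nu> by fact
  interpret prod: product_sigma_finite "\<lambda>_. \<nu>" by standard
  interpret P: prob_space "iid_sample I \<nu>" by (intro prob_space_PiM \<nu>)
  let ?P = "iid_sample I \<nu>"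
  show ?thesis
  proof (rule prod.PiM_eqI)
    fix A :: "'i \<times> bool \<Rightarrow> 'u set" assume A: "\<And>j. j \<in> I \<times> UNIV \<Longrightarrow> A j \<in> sets \<nu>"
    let ?T = "\<lambda>b. Pi\<^sub>E I (\<lambda>i. A (i, b))"
    have T: "?T b \<in> sets ?P" for b
      using A I by (intro sets_PiM_I_finite) auto
    have vimage: "pair_sample I -` Pi\<^sub>E (I \<times> UNIV) A \<inter> space (?P \<Otimes>\<^sub>M ?P) = ?T True \<times> ?T False"
    proof (intro equalityI subsetI)
      fix z assume z: "z \<in> pair_sample I -` Pi\<^sub>E (I \<times> UNIV) A \<inter> space (?P \<Otimes>\<^sub>M ?P)"
      then have "pair_sample I z (i, b) \<in> A (i, b)" if "i \<in> I" for i b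
        using that by (intro PiE_mem[of _ "I \<times> UNIV" A]) auto
      from this[of _ True] this[of _ False] show "z \<in> ?T True \<times> ?T False"
        using z by (cases z) (auto simp: pair_sample_def space_pair_measure space_PiM PiE_iff)
    next
      fix z assume z: "z \<in> ?T True \<times> ?T False"
      then have "z \<in> space ?P \<times> space ?P" using T[THEN sets.sets_into_space] by blast
      moreover have "pair_sample I z \<in> Pi\<^sub>E (I \<times> UNIV) A"
        using z by (cases z) (auto simp: pair_sample_def PiE_iff split: if_splits)
      ultimately show "z \<in> pair_sample I -` Pi\<^sub>E (I \<times> UNIV) A \<inter> space (?P \<Otimes>\<^sub>M ?P)"
        by (simp add: space_pair_measure)
    qed
    have "emeasure (distr (?P \<Otimes>\<^sub>M ?P) (iid_sample (I \<times> UNIV) \<nu>) (pair_sample I)) (Pi\<^sub>E (I \<times> UNIV) A) =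
        emeasure (?P \<Otimes>\<^sub>M ?P) (?T True \<times> ?T False)"
      unfolding vimage[symmetric] using A I
      by (intro emeasure_distr measurable_pair_sample sets_PiM_I_finite) auto
    also have "\<dots> = emeasure ?P (?T True) * emeasure ?P (?T False)"
      by (rule P.emeasure_pair_measure_Times[OF T T])
    also have "\<dots> = (\<Prod>i\<in>I. emeasure \<nu> (A (i, True))) * (\<Prod>i\<in>I. emeasure \<nu> (A (i, False)))"
      using A I by (subst (1 2) prod.emeasure_PiM) auto
    also have "\<dots> = (\<Prod>i\<in>I. \<Prod>b\<in>UNIV. emeasure \<nu> (A (i, b)))"
      by (simp add: prod.distrib UNIV_bool mult.commute)
    also have "\<dots> = (\<Prod>j\<in>I \<times> UNIV. emeasure \<nu> (A j))"
      by (simp add: prod.cartesian_product)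
    finally show "emeasure (distr (?P \<Otimes>\<^sub>M ?P) (iid_sample (I \<times> UNIV) \<nu>) (pair_sample I)) (Pi\<^sub>E (I \<times> UNIV) A) =
        (\<Prod>j\<in>I \<times> UNIV. emeasure \<nu> (A j))" .
  qed (use I in auto)
qed

text \<open>Comparing two samples eliminates the mean, so \<open>W\<close> matters only through its
  trace on finitely many points. Half of \<open>t\<close> is given away because the ghost sample may
  itself be off by nearly \<open>t / 2\<close>.\<close>

definition symmetrized_deviation :: "'u set set \<Rightarrow> 'i set \<Rightarrow> real \<Rightarrow> ('i \<times> bool \<Rightarrow> 'u) \<Rightarrow> bool" where
  "symmetrized_deviation \<W> I t y \<longleftrightarrow>
     (\<exists>W\<in>\<W>. t / 2 \<le> \<bar>\<Sum>i\<in>I. indicator W (y (i, True)) - indicator W (y (i, False))\<bar>)"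

definition deviation :: "'u measure \<Rightarrow> 'u set set \<Rightarrow> 'i set \<Rightarrow> real \<Rightarrow> ('i \<Rightarrow> 'u) \<Rightarrow> bool" where
  "deviation \<nu> \<W> I t z \<longleftrightarrow>
     (\<exists>W\<in>\<W>. t \<le> \<bar>(\<Sum>i\<in>I. indicator W (z i)) - real (card I) * measure \<nu> W\<bar>)"

text \<open>Symmetrization by a ghost sample. The events need not be measurable, but the set of first
  samples \<open>z\<close> whose section in \<open>H\<close> has probability at least one half is.\<close>

lemma symmetrization:
  fixes n t :: real
  assumes \<nu>: "prob_space \<nu>" and I: "finite I" "real (card I) \<le> n" and t: "0 < t" "4 * n \<le> t\<^sup>2"
    and \<W>: "\<W> \<subseteq> sets \<nu>" and H: "H \<in> sets (iid_sample (I \<times> UNIV) \<nu>)"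
    and sub: "\<And>y. y \<in> space (iid_sample (I \<times> UNIV) \<nu>) \<Longrightarrow> symmetrized_deviation \<W> I t y \<Longrightarrow> y \<in> H"
  obtains G where "G \<in> sets (iid_sample I \<nu>)"
    "\<And>z. z \<in> space (iid_sample I \<nu>) \<Longrightarrow> deviation \<nu> \<W> I t z \<Longrightarrow> z \<in> G"
    "measure (iid_sample I \<nu>) G \<le> 2 * measure (iid_sample (I \<times> UNIV) \<nu>) H"
proof -
  let ?P = "iid_sample I \<nu>" and ?Q = "iid_sample (I \<times> (UNIV :: bool set)) \<nu>"
  interpret \<nu>: prob_space \<nu> by fact
  interpret P: prob_space ?P by (intro prob_space_PiM \<nu>)
  interpret Q: prob_space ?Q by (intro prob_space_PiM \<nu>)
  define H' where "H' = pair_sample I -` H \<inter> space (?P \<Otimes>\<^sub>M ?P)"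
  have H': "H' \<in> sets (?P \<Otimes>\<^sub>M ?P)"
    unfolding H'_def by (rule measurable_sets[OF measurable_pair_sample H])
  define g where "g z = emeasure ?P (Pair z -` H')" for z
  have g [measurable]: "g \<in> borel_measurable ?P"
    unfolding g_def by (rule P.measurable_emeasure_Pair[OF H'])
  define G where "G = {z \<in> space ?P. ennreal (1 / 2) \<le> g z}"
  have G: "G \<in> sets ?P" unfolding G_def by measurable
  \<comment> \<open>Markov's inequality for the section probability \<open>g\<close>, then Fubini
    and the law of the merged sample.\<close>
  have "ennreal (1 / 2) * emeasure ?P G = (\<integral>\<^sup>+z. ennreal (1 / 2) * indicator G z \<partial>?P)"
    by (rule nn_integral_cmult_indicator[OF G, symmetric])
  also have "\<dots> \<le> (\<integral>\<^sup>+z. g z \<partial>?P)"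
    by (intro nn_integral_mono) (auto simp: G_def indicator_def)
  also have "\<dots> = emeasure (?P \<Otimes>\<^sub>M ?P) H'"
    unfolding g_def by (rule P.emeasure_pair_measure_alt[OF H', symmetric])
  also have "\<dots> = emeasure (distr (?P \<Otimes>\<^sub>M ?P) ?Q (pair_sample I)) H"
    unfolding H'_def by (rule emeasure_distr[OF measurable_pair_sample H, symmetric])
  also have "\<dots> = emeasure ?Q H" by (simp only: distr_pair_sample[OF \<nu> I(1)])
  finally have "1 / 2 * measure ?P G \<le> measure ?Q H"
    unfolding P.emeasure_eq_measure Q.emeasure_eq_measure
    by (subst (asm) ennreal_mult[symmetric]) auto
  then have "measure ?P G \<le> 2 * measure ?Q H" by simp
  moreover have "z \<in> G" if z: "z \<in> space ?P" "deviation \<nu> \<W> I t z" for z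
  proof -
    obtain W where W: "W \<in> \<W>" "t \<le> \<bar>(\<Sum>i\<in>I. indicator W (z i)) - real (card I) * measure \<nu> W\<bar>"
      using z(2) unfolding deviation_def by blast
    \<comment> \<open>\<open>W\<close> depends on the first sample alone and stays fixed while the
      ghost sample varies, so concentration for a single set suffices here.\<close>
    let ?L = "{z' \<in> space ?P. \<bar>(\<Sum>i\<in>I. indicator W (z' i)) - real (card I) * measure \<nu> W\<bar> < t / 2}"
    have "?L \<subseteq> Pair z -` H'"
    proof
      fix z' assume z': "z' \<in> ?L"
      let ?y = "pair_sample I (z, z')"
      have sp: "(z, z') \<in> space (?P \<Otimes>\<^sub>M ?P)" using z z' by (simp add: space_pair_measure)
      have "\<bar>(\<Sum>i\<in>I. indicator W (z' i)) - real (card I) * measure \<nu> W\<bar> < t / 2" using z' by simp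
      then have "t / 2 \<le> \<bar>(\<Sum>i\<in>I. indicator W (z i)) - (\<Sum>i\<in>I. indicator W (z' i) :: real)\<bar>"
        using W(2) by linarith
      moreover have "(\<Sum>i\<in>I. indicator W (?y (i, True)) - indicator W (?y (i, False)) :: real) =
          (\<Sum>i\<in>I. indicator W (z i)) - (\<Sum>i\<in>I. indicator W (z' i))"
        by (simp add: pair_sample_def sum_subtractf)
      ultimately have "symmetrized_deviation \<W> I t ?y"
        unfolding symmetrized_deviation_def using W(1) by (intro bexI[of _ W]) simp_all
      then have "?y \<in> H" using sub measurable_space[OF measurable_pair_sample sp] by blast
      then show "z' \<in> Pair z -` H'" using sp by (simp add: H'_def)
    qed
    moreover have "Pair z -` H' \<in> sets ?P" using H' by (rule sets_Pair1)
    ultimately have "measure ?P ?L \<le> measure ?P (Pair z -` H')"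
      by (rule P.finite_measure_mono)
    then have "1 / 2 \<le> measure ?P (Pair z -` H')"
      using coordinates_sum_concentration[OF \<nu> I t, of W] W(1) \<W> by auto
    then have "ennreal (1 / 2) \<le> g z"
      unfolding g_def P.emeasure_eq_measure by (rule ennreal_leI)
    then show ?thesis using z(1) unfolding G_def by blast
  qed
  ultimately show thesis using G that by blast
qed

section \<open>Random swaps\<close>

text \<open>A swap changes the sign of exactly the differences with index in \<open>s\<close>. A
  uniformly chosen \<open>s\<close> thus acts as a vector of Rademacher signs, while the law of the
  merged sample is invariant.\<close>

definition swap_sample :: "'i set \<Rightarrow> 'i set \<Rightarrow> ('i \<times> bool \<Rightarrow> 'u) \<Rightarrow> 'i \<times> bool \<Rightarrow> 'u" where
  "swap_sample I s y = (\<lambda>j\<in>I \<times> UNIV. y (fst j, if fst j \<in> s then \<not> snd j else snd j))"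

lemma distr_swap_sample:
  assumes "prob_space \<nu>"
  shows "distr (iid_sample (I \<times> UNIV) \<nu>) (iid_sample (I \<times> UNIV) \<nu>) (swap_sample I s) =
    iid_sample (I \<times> UNIV) \<nu>"
  unfolding swap_sample_def
  by (rule distr_PiM_reindex[of _ "\<lambda>_. \<nu>"]) (use assms in \<open>auto simp: inj_on_def split: if_splits\<close>)

lemma measurable_swap_sample:
  "swap_sample I s \<in> measurable (iid_sample (I \<times> UNIV) \<nu>) (iid_sample (I \<times> UNIV) \<nu>)"
  unfolding swap_sample_def by (rule measurable_restrict) auto

text \<open>For fixed \<open>y\<close> only the traces of \<open>\<W>\<close> on at most
  \<open>2 * n\<close> points matter, and each yields a sign sum with coefficients of modulus at
  most 1, to which the tail bound at \<open>t / 2\<close> applies.\<close>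

lemma card_swaps_deviation_le:
  fixes n :: nat and y :: "'i \<times> bool \<Rightarrow> 'u"
  assumes d: "\<And>A. finite A \<Longrightarrow> shatters \<W> A \<Longrightarrow> card A \<le> d"
    and I: "finite I" "card I \<le> n" "0 < n" and t: "0 < t"
  shows "real (card {s \<in> Pow I. symmetrized_deviation \<W> I t (swap_sample I s y)})
    \<le> (2 * real n + 1) ^ d * (2 * 2 ^ card I * exp (- t\<^sup>2 / (8 * real n)))"
proof -
  define S where "S = y ` (I \<times> UNIV)"
  define a :: "'u set \<Rightarrow> 'i \<Rightarrow> real" where "a W i = indicator W (y (i, True)) - indicator W (y (i, False))" for W i
  let ?B = "\<lambda>W. {s \<in> Pow I. t / 2 \<le> \<bar>\<Sum>i\<in>I. if i \<in> s then - a W i else a W i\<bar>}"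
  let ?tr = "(\<lambda>W. W \<inter> S) ` \<W>"
  have S: "finite S" using I(1) by (simp add: S_def)
  have "card S \<le> card (I \<times> (UNIV :: bool set))" unfolding S_def using I(1) by (intro card_image_le) auto
  also have "\<dots> = 2 * card I" by (simp add: card_cartesian_product)
  finally have "card S \<le> 2 * n" using I(2) by linarith
  then have "real (card ?tr) \<le> (2 * real n + 1) ^ d"
  proof -
    have "card ?tr \<le> (card S + 1) ^ d" by (rule card_traces_le[OF d S])
    also have "\<dots> \<le> (2 * n + 1) ^ d" using \<open>card S \<le> 2 * n\<close> by (intro power_mono) auto
    finally have "real (card ?tr) \<le> real ((2 * n + 1) ^ d)" by (simp only: of_nat_le_iff)
    then show ?thesis by (simp add: add.commute)
  qed
  have fin: "finite ?tr" by (rule finite_subset[of _ "Pow S"]) (use S in auto)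
  have a_trace: "a (W \<inter> S) i = a W i" if "i \<in> I" for W i
    using that unfolding a_def S_def by (auto simp: indicator_def)
  have "{s \<in> Pow I. symmetrized_deviation \<W> I t (swap_sample I s y)} \<subseteq> (\<Union>D\<in>?tr. ?B D)"
  proof
    fix s assume s: "s \<in> {s \<in> Pow I. symmetrized_deviation \<W> I t (swap_sample I s y)}"
    then obtain W where W: "W \<in> \<W>" "t / 2 \<le> \<bar>\<Sum>i\<in>I. indicator W (swap_sample I s y (i, True)) -
        indicator W (swap_sample I s y (i, False))\<bar>"
      unfolding symmetrized_deviation_def by auto
    have "(\<Sum>i\<in>I. indicator W (swap_sample I s y (i, True)) -
        indicator W (swap_sample I s y (i, False)) :: real) = (\<Sum>i\<in>I. if i \<in> s then - a (W \<inter> S) i else a (W \<inter> S) i)"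
      by (intro sum.cong refl) (auto simp: a_trace, auto simp: swap_sample_def a_def)
    then have "s \<in> ?B (W \<inter> S)" using s W(2) by auto
    then show "s \<in> (\<Union>D\<in>?tr. ?B D)" using W(1) by (intro UN_I[of "W \<inter> S"] imageI)
  qed
  then have "card {s \<in> Pow I. symmetrized_deviation \<W> I t (swap_sample I s y)} \<le> card (\<Union>D\<in>?tr. ?B D)"
    using fin I(1) by (intro card_mono finite_UN_I) auto
  also have "\<dots> \<le> (\<Sum>D\<in>?tr. card (?B D))" by (rule card_UN_le[OF fin])
  finally have "real (card {s \<in> Pow I. symmetrized_deviation \<W> I t (swap_sample I s y)}) \<le>
      (\<Sum>D\<in>?tr. real (card (?B D)))"
    by (simp only: of_nat_sum[symmetric] of_nat_le_iff)
  also have "\<dots> \<le> (\<Sum>D\<in>?tr. 2 * 2 ^ card I * exp (- (t / 2)\<^sup>2 / (2 * real n)))"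
    using I t by (intro sum_mono sign_sum_tail) (auto simp: a_def indicator_def)
  also have "\<dots> = real (card ?tr) * (2 * 2 ^ card I * exp (- t\<^sup>2 / (8 * real n)))"
    by (simp add: power_divide)
  also have "\<dots> \<le> (2 * real n + 1) ^ d * (2 * 2 ^ card I * exp (- t\<^sup>2 / (8 * real n)))"
    by (intro mult_right_mono \<open>real (card ?tr) \<le> (2 * real n + 1) ^ d\<close>) auto
  finally show ?thesis .
qed

text \<open>By invariance the measure of \<open>A\<close> is its average over all
  \<open>2 ^ card I\<close> swaps; after exchanging sum and integral the integrand counts the swaps
  taking \<open>y\<close> into \<open>A\<close>. The count is controlled because every point of
  \<open>A\<close> satisfies \<open>symmetrized_deviation\<close>.\<close>

lemma measure_symmetrized_deviation_le:
  fixes n :: nat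
  assumes \<nu>: "prob_space \<nu>" and d: "\<And>A. finite A \<Longrightarrow> shatters \<W> A \<Longrightarrow> card A \<le> d"
    and I: "finite I" "card I \<le> n" "0 < n" and t: "0 < t"
    and A: "A \<in> sets (iid_sample (I \<times> UNIV) \<nu>)" "\<And>y. y \<in> A \<Longrightarrow> symmetrized_deviation \<W> I t y"
  shows "measure (iid_sample (I \<times> UNIV) \<nu>) A \<le> 2 * (2 * real n + 1) ^ d * exp (- t\<^sup>2 / (8 * real n))"
proof -
  let ?Q = "iid_sample (I \<times> (UNIV :: bool set)) \<nu>" and ?sw = "swap_sample I"
  interpret Q: prob_space ?Q by (intro prob_space_PiM \<nu>)
  define K where "K = (2 * real n + 1) ^ d * (2 * 2 ^ card I * exp (- t\<^sup>2 / (8 * real n)))"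
  have K: "0 \<le> K" by (simp add: K_def)
  have vimage: "?sw s -` A \<inter> space ?Q \<in> sets ?Q" for s
    by (rule measurable_sets[OF measurable_swap_sample A(1)])
  have "ennreal (2 ^ card I * measure ?Q A) = (\<Sum>s\<in>Pow I. emeasure ?Q A)"
    using I(1) by (simp add: card_Pow Q.emeasure_eq_measure ennreal_mult ennreal_of_nat_eq_real_of_nat)
  also have "\<dots> = (\<Sum>s\<in>Pow I. emeasure ?Q (?sw s -` A \<inter> space ?Q))"
    by (intro sum.cong refl) (simp only: emeasure_distr[OF measurable_swap_sample A(1), symmetric] distr_swap_sample[OF \<nu>])
  also have "\<dots> = (\<Sum>s\<in>Pow I. \<integral>\<^sup>+y. indicator (?sw s -` A \<inter> space ?Q) y \<partial>?Q)"
    using vimage by simp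
  also have "\<dots> = (\<integral>\<^sup>+y. (\<Sum>s\<in>Pow I. indicator (?sw s -` A \<inter> space ?Q) y) \<partial>?Q)"
    using vimage by (intro nn_integral_sum[symmetric]) auto
  also have "\<dots> \<le> (\<integral>\<^sup>+y. ennreal K \<partial>?Q)"
  proof (intro nn_integral_mono)
    fix y assume y: "y \<in> space ?Q"
    have "(\<Sum>s\<in>Pow I. indicator (?sw s -` A \<inter> space ?Q) y :: ennreal) =
        (\<Sum>s\<in>Pow I. if ?sw s y \<in> A then 1 else 0)"
      using y by (intro sum.cong) (auto simp: indicator_def)
    also have "\<dots> = of_nat (card {s \<in> Pow I. ?sw s y \<in> A})"
      using I(1) by (simp add: sum.If_cases Int_def)
    also have "\<dots> = ennreal (real (card {s \<in> Pow I. ?sw s y \<in> A}))"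
      by (simp add: ennreal_of_nat_eq_real_of_nat)
    also have "\<dots> \<le> ennreal (real (card {s \<in> Pow I. symmetrized_deviation \<W> I t (?sw s y)}))"
      using I(1) A(2) by (intro ennreal_leI of_nat_mono card_mono) auto
    also have "\<dots> \<le> ennreal K"
      unfolding K_def by (intro ennreal_leI card_swaps_deviation_le[OF d I t])
    finally show "(\<Sum>s\<in>Pow I. indicator (?sw s -` A \<inter> space ?Q) y) \<le> ennreal K" .
  qed
  also have "\<dots> = ennreal K" by (simp add: Q.emeasure_space_1)
  finally have "2 ^ card I * measure ?Q A \<le> K" using K by (simp add: ennreal_le_iff)
  then have "2 ^ card I * measure ?Q A \<le> 2 ^ card I * (2 * (2 * real n + 1) ^ d * exp (- t\<^sup>2 / (8 * real n)))"
    unfolding K_def by (simp add: mult_ac)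
  then show ?thesis by simp
qed

text \<open>Replacing indicators by the parametrization \<open>f\<close> turns the existential over
  \<open>W\<close> into a projection along \<open>T\<close> of a set that is jointly measurable in
  sample and parameter.\<close>

lemma symmetrized_deviation_measurable:
  fixes I :: "'i set" and \<nu> :: "'u measure"
  assumes \<nu>: "prob_space \<nu>" and I: "finite I"
    and perm: "permissible TYPE('t::metric_space) \<nu> {indicator W | W. W \<in> \<W>}"
  shows "{y \<in> space (iid_sample (I \<times> UNIV) \<nu>). symmetrized_deviation \<W> I t y}
    \<in> sets (completion (iid_sample (I \<times> UNIV) \<nu>))"
proof -
  let ?Q = "iid_sample (I \<times> (UNIV :: bool set)) \<nu>"
  interpret Q: prob_space ?Q by (intro prob_space_PiM \<nu>)
  obtain K T :: "'t set" and f :: "'u \<Rightarrow> 't \<Rightarrow> real" where K: "compact K" and T: "T \<subseteq> K" "analytic_set T"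
    and ind: "{indicator W | W. W \<in> \<W>} = {(\<lambda>x. f x t) | t. t \<in> T}"
    and f: "(\<lambda>(x, t). f x t) \<in> borel_measurable (\<nu> \<Otimes>\<^sub>M restrict_space borel T)"
    using perm unfolding permissible_def by blast
  let ?R = "restrict_space (borel :: 't measure) T"
  define F where "F p = (\<Sum>i\<in>I. f (fst p (i, True)) (snd p) - f (fst p (i, False)) (snd p))" for p
  have f_comp: "(\<lambda>p. f (fst p j) (snd p)) \<in> borel_measurable (?Q \<Otimes>\<^sub>M ?R)" if "j \<in> I \<times> UNIV" for j
  proof -
    have "(\<lambda>p. (fst p j, snd p)) \<in> measurable (?Q \<Otimes>\<^sub>M ?R) (\<nu> \<Otimes>\<^sub>M ?R)"
      using that by (intro measurable_Pair measurable_compose[OF measurable_fst]) auto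
    from measurable_compose[OF this f] show ?thesis by simp
  qed
  have F [measurable]: "F \<in> borel_measurable (?Q \<Otimes>\<^sub>M ?R)"
    unfolding F_def by (intro borel_measurable_sum borel_measurable_diff f_comp) auto
  define E where "E = {p \<in> space (?Q \<Otimes>\<^sub>M ?R). t / 2 \<le> \<bar>F p\<bar>}"
  have E: "E \<in> sets (?Q \<Otimes>\<^sub>M ?R)" unfolding E_def by measurable
  have sp: "space (?Q \<Otimes>\<^sub>M ?R) = space ?Q \<times> T"
    by (simp add: space_pair_measure space_restrict_space)
  have "{y \<in> space ?Q. symmetrized_deviation \<W> I t y} = fst ` E"
  proof (intro equalityI subsetI)
    fix y assume y: "y \<in> {y \<in> space ?Q. symmetrized_deviation \<W> I t y}"
    then obtain W where W: "W \<in> \<W>"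
      "t / 2 \<le> \<bar>\<Sum>i\<in>I. indicator W (y (i, True)) - indicator W (y (i, False))\<bar>"
      unfolding symmetrized_deviation_def by auto
    have "(indicator W :: _ \<Rightarrow> real) \<in> {(\<lambda>x. f x t) | t. t \<in> T}" using W(1) ind by blast
    then obtain \<tau> where \<tau>: "\<tau> \<in> T" "(indicator W :: _ \<Rightarrow> real) = (\<lambda>x. f x \<tau>)" by blast
    have "(y, \<tau>) \<in> E" using y W(2) \<tau> by (simp add: E_def sp F_def)
    then show "y \<in> fst ` E" by (rule image_eqI[rotated]) simp
  next
    fix y assume "y \<in> fst ` E"
    then obtain \<tau> where \<tau>: "(y, \<tau>) \<in> E" by force
    then have "(\<lambda>x. f x \<tau>) \<in> {indicator W | W. W \<in> \<W>}" unfolding ind by (auto simp: E_def sp)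
    then obtain W where W: "W \<in> \<W>" "(\<lambda>x. f x \<tau>) = indicator W" by blast
    have "f x \<tau> = indicator W x" for x using fun_cong[OF W(2), of x] .
    then show "y \<in> {y \<in> space ?Q. symmetrized_deviation \<W> I t y}"
      using \<tau> W(1) by (auto simp: E_def sp F_def symmetrized_deviation_def intro!: bexI[of _ W])
  qed
  also have "\<dots> \<in> sets (completion ?Q)"
    by (rule measurable_projection[OF _ K T(2,1) E]) unfold_locales
  finally show ?thesis .
qed

text \<open>The symmetrized event is \<open>S \<union> N\<close> with \<open>N\<close> inside a null
  set \<open>N'\<close>: the swap bound applies to \<open>S\<close>, the ghost step to the cover
  \<open>S \<union> N'\<close>, and both have the same measure. The constant 4 is 2 from the ghost
  sample times 2 from the two-sided tail.\<close>

theorem VC_deviation_bound: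
  fixes n :: nat
  assumes \<nu>: "prob_space \<nu>" and \<W>: "\<W> \<subseteq> sets \<nu>"
    and d: "\<And>A. finite A \<Longrightarrow> shatters \<W> A \<Longrightarrow> card A \<le> d"
    and perm: "permissible TYPE('t::metric_space) \<nu> {indicator W | W. W \<in> \<W>}"
    and I: "finite I" "card I \<le> n" "0 < n" and t: "0 < t" "4 * real n \<le> t\<^sup>2"
  obtains G where "G \<in> sets (iid_sample I \<nu>)"
    "\<And>z. z \<in> space (iid_sample I \<nu>) \<Longrightarrow> deviation \<nu> \<W> I t z \<Longrightarrow> z \<in> G"
    "measure (iid_sample I \<nu>) G \<le> 4 * (2 * real n + 1) ^ d * exp (- t\<^sup>2 / (8 * real n))"
proof -
  let ?Q = "iid_sample (I \<times> (UNIV :: bool set)) \<nu>"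
  obtain S N N' where SN: "{y \<in> space ?Q. symmetrized_deviation \<W> I t y} = S \<union> N"
    "N \<subseteq> N'" "N' \<in> null_sets ?Q" "S \<in> sets ?Q"
    using symmetrized_deviation_measurable[OF \<nu> I(1) perm, of t] by (rule sets_completionE)
  have "S \<union> N' \<in> sets ?Q" using SN by auto
  moreover have "y \<in> S \<union> N'" if "y \<in> space ?Q" "symmetrized_deviation \<W> I t y" for y
    using SN(1,2) that by blast
  ultimately obtain G where G: "G \<in> sets (iid_sample I \<nu>)"
    "\<And>z. z \<in> space (iid_sample I \<nu>) \<Longrightarrow> deviation \<nu> \<W> I t z \<Longrightarrow> z \<in> G"
    "measure (iid_sample I \<nu>) G \<le> 2 * measure ?Q (S \<union> N')"
    using symmetrization[OF \<nu> I(1) _ t \<W>, of "S \<union> N'"] I(2) by auto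
  have "measure ?Q (S \<union> N') = measure ?Q S"
    using SN(3,4) by (simp add: measure_Un_null_set)
  also have "\<dots> \<le> 2 * (2 * real n + 1) ^ d * exp (- t\<^sup>2 / (8 * real n))"
    by (rule measure_symmetrized_deviation_le[OF \<nu> d I t(1) SN(4)]) (use SN(1) in blast)+
  finally show thesis using G by (intro that[of G]) auto
qed

section \<open>Empirical measures on the product\<close>

lemma permissible_cong_sets:
  fixes S S' :: "'a measure"
  assumes "sets S = sets S'" "permissible TYPE('t::metric_space) S \<F>"
  shows "permissible TYPE('t) S' \<F>"
proof -
  have "(borel_measurable (S \<Otimes>\<^sub>M restrict_space borel T) :: ('a \<times> 't \<Rightarrow> real) set) =
      borel_measurable (S' \<Otimes>\<^sub>M restrict_space borel T)"
    for T :: "'t set"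
    using assms(1) by (intro measurable_cong_sets sets_pair_measure_cong refl)
  then show ?thesis using assms(2) unfolding permissible_def by simp
qed

lemma prob_completion_eq_1:
  assumes M: "prob_space M" and P: "AE x in M. P x"
  shows "\<P>(x in completion M. P x) = 1"
proof -
  interpret prob_space M by fact
  interpret c: prob_space "completion M" by (rule prob_space_completion)
  have "Measurable.pred (completion M) (\<lambda>x. \<not> P x)"
    using P by (intro sets_completion_AE) simp
  then have "Measurable.pred (completion M) (\<lambda>x. \<not> \<not> P x)" by measurable
  then have "{x \<in> space (completion M). P x} \<in> sets (completion M)" by (simp add: pred_def)
  moreover have "AE x in completion M. P x" using P by (rule AE_completion)
  ultimately show ?thesis using c.prob_Collect_eq_1 by blast
qed

definition grid_indices :: "nat \<Rightarrow> real set \<Rightarrow> nat set" where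
  "grid_indices n B = {i \<in> {1..n}. real i / real n \<in> B}"

text \<open>\<open>grid_indices n B\<close> is determined by the trace of \<open>B\<close> on the
  grid.\<close>

lemma card_grid_indices_image_le:
  assumes "\<And>A. finite A \<Longrightarrow> shatters \<B> A \<Longrightarrow> card A \<le> d"
  shows "card (grid_indices n ` \<B>) \<le> (n + 1) ^ d"
proof -
  let ?S = "(\<lambda>i. real i / real n) ` {1..n}"
  have S: "finite ?S" by simp
  have fin: "finite ((\<lambda>B. B \<inter> ?S) ` \<B>)" by (rule finite_subset[of _ "Pow ?S"]) auto
  have "grid_indices n B = grid_indices n (B \<inter> ?S)" for B by (auto simp: grid_indices_def)
  then have "grid_indices n ` \<B> = grid_indices n ` (\<lambda>B. B \<inter> ?S) ` \<B>" by (simp add: image_image)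
  then have "card (grid_indices n ` \<B>) \<le> card ((\<lambda>B. B \<inter> ?S) ` \<B>)"
    using card_image_le[OF fin, of "grid_indices n"] by simp
  also have "\<dots> \<le> (card ?S + 1) ^ d" by (rule card_traces_le[OF assms S])
  also have "\<dots> \<le> (n + 1) ^ d"
    using card_image_le[of "{1..n}" "\<lambda>i. real i / real n"] by (intro power_mono) auto
  finally show ?thesis .
qed

text \<open>Links the error to \<open>deviation\<close>: an error of at least
  \<open>\<epsilon>\<close> is a deviation at threshold \<open>n * \<epsilon>\<close> for positive
  \<open>n\<close>. At \<open>n = 0\<close> both sides vanish, as division by zero gives 0.\<close>

lemma emp_prod_minus_grid_measure:
  assumes B: "B \<in> sets borel" "B \<subseteq> {0..1}"
  shows "emp_prod x n B W - measure (grid_measure n) B * measure \<nu> W =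
    ((\<Sum>i\<in>grid_indices n B. indicator W (x i)) - real (card (grid_indices n B)) * measure \<nu> W) / real n"
proof -
  have sum_eq: "(\<Sum>i=1..n. indicator B (real i / real n) * g i) = (\<Sum>i\<in>grid_indices n B. g i)"
    for g :: "nat \<Rightarrow> real"
    unfolding grid_indices_def sum.inter_filter[OF finite_atLeastAtMost]
    by (intro sum.cong) (auto simp: indicator_def)
  have "measure (grid_measure n) B = real (card (grid_indices n B)) / real n"
    unfolding measure_grid_measure[OF B] using sum_eq[of "\<lambda>_. 1"] by simp
  then show ?thesis unfolding emp_prod_def sum_eq by (simp add: diff_divide_distrib)
qed

lemma deviation_cong:
  "(\<And>i. i \<in> I \<Longrightarrow> x i = y i) \<Longrightarrow> deviation \<nu> \<W> I t x \<longleftrightarrow> deviation \<nu> \<W> I t y"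
  unfolding deviation_def by (simp cong: sum.cong)

lemma summable_polynomial_exp_decay:
  fixes c :: real
  assumes "0 < c"
  shows "summable (\<lambda>n. (2 * real n + 1) ^ k * exp (- c * real n))"
proof -
  \<comment> \<open>The polynomial is bounded through one term of the exponential series at
    \<open>\<delta> * (2 * n + 1)\<close>; its growth \<open>exp (c * n / 2)\<close> uses up half of
    the decay.\<close>
  define \<delta> where "\<delta> = c / 4"
  have \<delta>: "0 < \<delta>" using assms by (simp add: \<delta>_def)
  have bound: "(2 * real n + 1) ^ k * exp (- c * real n) \<le> fact k / \<delta> ^ k * exp \<delta> * exp (- c / 2) ^ n" for n
  proof -
    have "(\<delta> * (2 * real n + 1)) ^ k / fact k \<le> exp (\<delta> * (2 * real n + 1))"
    proof -
      let ?x = "\<delta> * (2 * real n + 1)"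
      have "(\<Sum>i\<in>{k}. ?x ^ i /\<^sub>R fact i) \<le> (\<Sum>i. ?x ^ i /\<^sub>R fact i)"
        using \<delta> by (intro sum_le_suminf summable_exp_generic) auto
      then show ?thesis by (simp add: exp_def divide_inverse mult.commute)
    qed
    then have "(2 * real n + 1) ^ k \<le> fact k / \<delta> ^ k * exp (\<delta> * (2 * real n + 1))"
    proof -
      have "b \<le> c / a * e" if "a * b / c \<le> e" "0 < a" "0 < c" for a b c e :: real
        using that by (simp add: field_simps)
      then show ?thesis
        using \<open>(\<delta> * (2 * real n + 1)) ^ k / fact k \<le> exp (\<delta> * (2 * real n + 1))\<close> \<delta>
        unfolding power_mult_distrib by simp
    qed
    then have "(2 * real n + 1) ^ k * exp (- c * real n) \<le>
        fact k / \<delta> ^ k * exp (\<delta> * (2 * real n + 1)) * exp (- c * real n)"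
      by (rule mult_right_mono) simp
    also have "\<dots> = fact k / \<delta> ^ k * exp (\<delta> * (2 * real n + 1) + - c * real n)"
      by (simp only: exp_add mult.assoc)
    also have "\<delta> * (2 * real n + 1) + - c * real n = \<delta> + real n * (- c / 2)"
      by (simp add: \<delta>_def algebra_simps)
    also have "exp (\<delta> + real n * (- c / 2)) = exp \<delta> * exp (- c / 2) ^ n"
      by (simp only: exp_add exp_of_nat_mult)
    finally show ?thesis by (simp only: mult.assoc)
  qed
  have "summable (\<lambda>n. fact k / \<delta> ^ k * exp \<delta> * exp (- c / 2) ^ n)"
    using assms by (intro summable_mult summable_geometric) simp
  then show ?thesis
    by (rule summable_comparison_test'[where N = 0]) (use bound in auto)
qed

section \<open>Almost sure convergence for an i.i.d. sequence\<close>

locale vc_iid_sequence = prob_space M for M :: "'w measure" +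
  fixes U \<nu> :: "'u measure" and X :: "nat \<Rightarrow> 'w \<Rightarrow> 'u" and \<W> :: "'u set set" and d :: nat
  assumes indep: "indep_vars (\<lambda>_. U) X {1..}"
    and distr_X: "\<And>i. i \<ge> 1 \<Longrightarrow> distr M U (X i) = \<nu>"
    and \<W>: "\<W> \<subseteq> sets U"
    and shattered: "\<And>A. finite A \<Longrightarrow> shatters \<W> A \<Longrightarrow> card A \<le> d"
begin

lemma rv_X [measurable]: "i \<ge> 1 \<Longrightarrow> X i \<in> measurable M U"
  using indep unfolding indep_vars_def by auto

lemma sets_\<nu>: "sets \<nu> = sets U"
  using distr_X[of 1] by (metis order_refl sets_distr)

lemma prob_space_\<nu>: "prob_space \<nu>"
  using prob_space_distr[OF rv_X, of 1] distr_X[of 1] by simp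

text \<open>By independence the variables with index in \<open>I\<close> have joint law
  \<open>iid_sample I \<nu>\<close>, so the bound pulls back to \<open>M\<close>.\<close>

lemma deviation_event:
  fixes n :: nat
  assumes perm: "permissible TYPE('t::metric_space) U {indicator W | W. W \<in> \<W>}"
    and I: "I \<subseteq> {1..n}" "0 < n" and t: "0 < t" "4 * real n \<le> t\<^sup>2"
  obtains E where "E \<in> sets M" "\<And>\<omega>. \<omega> \<in> space M \<Longrightarrow> deviation \<nu> \<W> I t (\<lambda>i. X i \<omega>) \<Longrightarrow> \<omega> \<in> E"
    "measure M E \<le> 4 * (2 * real n + 1) ^ d * exp (- t\<^sup>2 / (8 * real n))"
proof (cases "I = {}")
  \<comment> \<open>The empty sum cannot deviate by a positive \<open>t\<close>; the product
    characterization of independence used below asks for a nonempty \<open>I\<close>.\<close>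
  case True
  then show thesis using t by (intro that[of "{}"]) (auto simp: deviation_def)
next
  case False
  have fin: "finite I" and card: "card I \<le> n"
    using I(1) finite_subset card_mono[of "{1..n}" I] by auto
  have perm': "permissible TYPE('t) \<nu> {indicator W | W. W \<in> \<W>}"
    using perm by (rule permissible_cong_sets[OF sets_\<nu>[symmetric]])
  have \<W>': "\<W> \<subseteq> sets \<nu>" using \<W> sets_\<nu> by simp
  obtain G where G: "G \<in> sets (iid_sample I \<nu>)"
    "\<And>z. z \<in> space (iid_sample I \<nu>) \<Longrightarrow> deviation \<nu> \<W> I t z \<Longrightarrow> z \<in> G"
    "measure (iid_sample I \<nu>) G \<le> 4 * (2 * real n + 1) ^ d * exp (- t\<^sup>2 / (8 * real n))"
    by (rule VC_deviation_bound[OF prob_space_\<nu> \<W>' shattered perm' fin card I(2) t]) (assumption | rule that)+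
  let ?X = "\<lambda>\<omega>. \<lambda>i\<in>I. X i \<omega>"
  have X: "X i \<in> measurable M U" if "i \<in> I" for i using that I(1) by (intro rv_X) auto
  have sets_eq: "sets (Pi\<^sub>M I (\<lambda>_. U)) = sets (iid_sample I \<nu>)"
    by (intro sets_PiM_cong refl) (simp add: sets_\<nu>)
  have meas: "?X \<in> measurable M (Pi\<^sub>M I (\<lambda>_. U))" by (intro measurable_restrict X)
  have "indep_vars (\<lambda>_. U) X I" by (rule indep_vars_subset[OF indep]) (use I(1) in auto)
  then have "distr M (Pi\<^sub>M I (\<lambda>_. U)) ?X = Pi\<^sub>M I (\<lambda>i. distr M U (X i))"
    using indep_vars_iff_distr_eq_PiM'[OF False, where M' = "\<lambda>_. U" and X = X] X by simp
  also have "\<dots> = iid_sample I \<nu>" using I(1) by (intro PiM_cong refl distr_X) auto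
  finally have distr: "distr M (Pi\<^sub>M I (\<lambda>_. U)) ?X = iid_sample I \<nu>" .
  have G': "G \<in> sets (Pi\<^sub>M I (\<lambda>_. U))" using G(1) sets_eq by simp
  show thesis
  proof (rule that[of "?X -` G \<inter> space M"])
    show "?X -` G \<inter> space M \<in> sets M" by (rule measurable_sets[OF meas G'])
    show "\<omega> \<in> ?X -` G \<inter> space M" if \<omega>: "\<omega> \<in> space M" "deviation \<nu> \<W> I t (\<lambda>i. X i \<omega>)" for \<omega>
    proof -
      have "?X \<omega> \<in> space (iid_sample I \<nu>)"
        using measurable_space[OF meas \<omega>(1)] sets_eq_imp_space_eq[OF sets_eq] by simp
      moreover have "deviation \<nu> \<W> I t (?X \<omega>)"
        using \<omega>(2) deviation_cong[of I "?X \<omega>" "\<lambda>i. X i \<omega>"] by simp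
      ultimately show ?thesis using G(2) \<omega>(1) by simp
    qed
    show "measure M (?X -` G \<inter> space M) \<le> 4 * (2 * real n + 1) ^ d * exp (- t\<^sup>2 / (8 * real n))"
      using measure_distr[OF meas G'] distr G(3) by simp
  qed
qed

lemma AE_eventually_no_deviation:
  assumes perm: "permissible TYPE('t::metric_space) U {indicator W | W. W \<in> \<W>}"
    and \<B>: "\<And>A. finite A \<Longrightarrow> shatters \<B> A \<Longrightarrow> card A \<le> d'" and \<epsilon>: "0 < \<epsilon>"
  shows "AE \<omega> in M. \<forall>\<^sub>F n in sequentially.
    \<forall>B\<in>\<B>. \<not> deviation \<nu> \<W> (grid_indices n B) (real n * \<epsilon>) (\<lambda>i. X i \<omega>)"
proof -
  \<comment> \<open>From \<open>N\<close> on, \<open>4 * n \<le> (n * \<epsilon>)\<^sup>2\<close>,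
    as the ghost step demands.\<close>
  obtain N where N: "4 / \<epsilon>\<^sup>2 < real N" using reals_Archimedean2 by blast
  have "0 < 4 / \<epsilon>\<^sup>2" using \<epsilon> by simp
  then have "0 < real N" using N by (rule less_trans)
  then have "0 < N" by simp
  define b where "b n = 4 * (2 * real n + 1) ^ d * exp (- (\<epsilon>\<^sup>2 / 8) * real n)" for n
  define covers where "covers n J E \<longleftrightarrow> E \<in> sets M \<and>
      (\<forall>\<omega>\<in>space M. deviation \<nu> \<W> J (real n * \<epsilon>) (\<lambda>i. X i \<omega>) \<longrightarrow> \<omega> \<in> E) \<and> measure M E \<le> b n"
    for n J E
  have covers_ex: "\<exists>E. covers n J E" if n: "N \<le> n" and J: "J \<subseteq> {1..n}" for n J
  proof -
    have n0: "0 < n" using n \<open>0 < N\<close> by simp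
    have "4 / \<epsilon>\<^sup>2 \<le> real n" using n N by linarith
    then have "4 \<le> real n * \<epsilon>\<^sup>2" using \<epsilon> by (simp add: pos_divide_le_eq)
    then have "real n * 4 \<le> real n * (real n * \<epsilon>\<^sup>2)" by (rule mult_left_mono) simp
    then have t: "4 * real n \<le> (real n * \<epsilon>)\<^sup>2" by (simp add: power_mult_distrib power2_eq_square mult_ac)
    have eq: "- (real n * \<epsilon>)\<^sup>2 / (8 * real n) = - (\<epsilon>\<^sup>2 / 8) * real n"
      using n0 by (simp add: power2_eq_square)
    obtain E where "E \<in> sets M"
      "\<And>\<omega>. \<omega> \<in> space M \<Longrightarrow> deviation \<nu> \<W> J (real n * \<epsilon>) (\<lambda>i. X i \<omega>) \<Longrightarrow> \<omega> \<in> E"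
      "measure M E \<le> 4 * (2 * real n + 1) ^ d * exp (- (real n * \<epsilon>)\<^sup>2 / (8 * real n))"
      using deviation_event[OF perm J n0 _ t] n0 \<epsilon> by auto
    then show ?thesis unfolding eq covers_def b_def by blast
  qed
  define E where "E n J = (SOME E. covers n J E)" for n J
  have "covers n J (E n J)" if "N \<le> n" "J \<subseteq> {1..n}" for n J
    unfolding E_def by (rule someI_ex[OF covers_ex[OF that]])
  then have E: "\<And>n J. N \<le> n \<Longrightarrow> J \<subseteq> {1..n} \<Longrightarrow> E n J \<in> sets M"
    "\<And>n J \<omega>. N \<le> n \<Longrightarrow> J \<subseteq> {1..n} \<Longrightarrow> \<omega> \<in> space M \<Longrightarrow>
      deviation \<nu> \<W> J (real n * \<epsilon>) (\<lambda>i. X i \<omega>) \<Longrightarrow> \<omega> \<in> E n J"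
    "\<And>n J. N \<le> n \<Longrightarrow> J \<subseteq> {1..n} \<Longrightarrow> measure M (E n J) \<le> b n"
    unfolding covers_def by blast+
  \<comment> \<open>All \<open>B\<close> with the same grid indices share one event, so the union
    over a possibly uncountable \<open>\<B>\<close> becomes finite.\<close>
  define \<J> where "\<J> n = grid_indices n ` \<B>" for n
  have \<J>: "J \<subseteq> {1..n}" if "J \<in> \<J> n" for n J
    using that by (auto simp: \<J>_def grid_indices_def)
  have fin: "finite (\<J> n)" for n by (rule finite_subset[of _ "Pow {1..n}"]) (use \<J> in auto)
  \<comment> \<open>No covers are available before \<open>N\<close>; dropping finitely many
    \<open>n\<close> does not affect Borel--Cantelli.\<close>
  define A where "A n = (if N \<le> n then \<Union>J\<in>\<J> n. E n J else {})" for n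
  have A_meas: "A n \<in> sets M" for n
    unfolding A_def using E(1) \<J> fin by (auto intro!: sets.finite_UN)
  have b_nonneg: "0 \<le> b n" for n by (simp add: b_def)
  have A_le: "measure M (A n) \<le> 4 * ((2 * real n + 1) ^ (d' + d) * exp (- (\<epsilon>\<^sup>2 / 8) * real n))" for n
  proof (cases "N \<le> n")
    case True
    have "measure M (A n) = measure M (\<Union>J\<in>\<J> n. E n J)" using True by (simp add: A_def)
    also have "\<dots> \<le> (\<Sum>J\<in>\<J> n. measure M (E n J))"
      using E(1)[OF True] \<J> by (intro finite_measure_subadditive_finite fin) auto
    also have "\<dots> \<le> (\<Sum>J\<in>\<J> n. b n)" using E(3)[OF True] \<J> by (intro sum_mono) auto
    also have "\<dots> = real (card (\<J> n)) * b n" by simp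
    also have "\<dots> \<le> (2 * real n + 1) ^ d' * b n"
    proof (rule mult_right_mono[OF _ b_nonneg])
      have "real (card (\<J> n)) \<le> real ((n + 1) ^ d')"
        unfolding \<J>_def of_nat_le_iff by (rule card_grid_indices_image_le[OF \<B>])
      also have "\<dots> = (real n + 1) ^ d'" by (simp add: add.commute)
      also have "\<dots> \<le> (2 * real n + 1) ^ d'" by (intro power_mono) auto
      finally show "real (card (\<J> n)) \<le> (2 * real n + 1) ^ d'" .
    qed
    finally show ?thesis by (simp add: b_def power_add mult_ac)
  qed (simp add: A_def)
  have "summable (\<lambda>n. measure M (A n))"
  proof (rule summable_comparison_test'[where N = 0])
    show "summable (\<lambda>n. 4 * ((2 * real n + 1) ^ (d' + d) * exp (- (\<epsilon>\<^sup>2 / 8) * real n)))"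
      using \<epsilon> by (intro summable_mult summable_polynomial_exp_decay) simp
    show "norm (measure M (A n)) \<le> 4 * ((2 * real n + 1) ^ (d' + d) * exp (- (\<epsilon>\<^sup>2 / 8) * real n))" for n
      using A_le[of n] by simp
  qed
  then have "AE \<omega> in M. eventually (\<lambda>n. \<omega> \<in> space M - A n) sequentially"
    using A_meas by (intro borel_cantelli_AE1) (auto simp: less_top[symmetric])
  then show ?thesis
  proof (rule AE_mp, intro AE_I2 impI)
    fix \<omega> assume \<omega>: "\<omega> \<in> space M"
    assume "\<forall>\<^sub>F n in sequentially. \<omega> \<in> space M - A n"
    moreover have "\<forall>\<^sub>F n in sequentially. N \<le> n" by (rule eventually_ge_at_top)
    ultimately show "\<forall>\<^sub>F n in sequentially.
        \<forall>B\<in>\<B>. \<not> deviation \<nu> \<W> (grid_indices n B) (real n * \<epsilon>) (\<lambda>i. X i \<omega>)"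
    proof eventually_elim
      case (elim n)
      show ?case
      proof (intro ballI notI)
        fix B assume B: "B \<in> \<B>"
          and dev: "deviation \<nu> \<W> (grid_indices n B) (real n * \<epsilon>) (\<lambda>i. X i \<omega>)"
        have J: "grid_indices n B \<in> \<J> n" using B by (simp add: \<J>_def)
        have "\<omega> \<in> E n (grid_indices n B)" by (rule E(2)[OF elim(2) \<J>[OF J] \<omega> dev])
        then show False using J elim by (auto simp: A_def)
      qed
    qed
  qed
qed

lemma AE_emp_prod_uniform_limit:
  assumes perm: "permissible TYPE('t::metric_space) U {indicator W | W. W \<in> \<W>}"
    and \<B>: "\<And>A. finite A \<Longrightarrow> shatters \<B> A \<Longrightarrow> card A \<le> d'"
    and borel: "\<And>B. B \<in> \<B> \<Longrightarrow> B \<in> sets borel \<and> B \<subseteq> {0..1}"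
  shows "AE \<omega> in M. (\<lambda>n. SUP B\<in>\<B>. SUP W\<in>\<W>.
      ennreal \<bar>emp_prod (\<lambda>i. X i \<omega>) n B W - measure (grid_measure n) B * measure \<nu> W\<bar>) \<longlonglongrightarrow> 0"
proof -
  \<comment> \<open>Countably many thresholds keep the exceptional null set independent of the
    threshold.\<close>
  have "AE \<omega> in M. \<forall>k. \<forall>\<^sub>F n in sequentially.
      \<forall>B\<in>\<B>. \<not> deviation \<nu> \<W> (grid_indices n B) (real n * inverse (real (Suc k))) (\<lambda>i. X i \<omega>)"
    unfolding AE_all_countable by (intro allI AE_eventually_no_deviation[OF perm \<B>]) simp_all
  then show ?thesis
  proof (rule AE_mp, intro AE_I2 impI)
    fix \<omega> assume *: "\<forall>k. \<forall>\<^sub>F n in sequentially.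
      \<forall>B\<in>\<B>. \<not> deviation \<nu> \<W> (grid_indices n B) (real n * inverse (real (Suc k))) (\<lambda>i. X i \<omega>)"
    let ?f = "\<lambda>n. SUP B\<in>\<B>. SUP W\<in>\<W>.
      ennreal \<bar>emp_prod (\<lambda>i. X i \<omega>) n B W - measure (grid_measure n) B * measure \<nu> W\<bar>"
    show "?f \<longlonglongrightarrow> 0"
    proof (rule order_tendstoI)
      fix e :: ennreal assume e: "0 < e"
      obtain k where k: "ennreal (inverse (real (Suc k))) < e"
      proof (cases e)
        case (real r)
        then have "0 < r" using e by simp
        then obtain k where "inverse (real (Suc k)) < r" using reals_Archimedean by blast
        then have "ennreal (inverse (real (Suc k))) < e" unfolding real(2) using \<open>0 < r\<close> by (intro ennreal_lessI)
        then show thesis by (rule that)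
      next
        case top
        then show thesis by (intro that[of 0]) simp
      qed
      from *[rule_format, of k] eventually_gt_at_top[of 0]
      show "\<forall>\<^sub>F n in sequentially. ?f n < e"
      proof eventually_elim
        case (elim n)
        have "?f n \<le> ennreal (inverse (real (Suc k)))"
        proof (intro SUP_least ennreal_leI)
          fix B W assume BW: "B \<in> \<B>" "W \<in> \<W>"
          have "\<bar>(\<Sum>i\<in>grid_indices n B. indicator W (X i \<omega>)) - real (card (grid_indices n B)) * measure \<nu> W\<bar>
              < real n * inverse (real (Suc k))"
            using elim(1) BW unfolding deviation_def by (meson not_le)
          then show "\<bar>emp_prod (\<lambda>i. X i \<omega>) n B W - measure (grid_measure n) B * measure \<nu> W\<bar>
              \<le> inverse (real (Suc k))"
            using elim(2) borel[OF BW(1)]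
            by (subst emp_prod_minus_grid_measure) (auto simp: pos_divide_le_eq mult.commute)
        qed
        then show ?case using k by (rule le_less_trans)
      qed
    qed simp
  qed
qed

end

theorem theorem5:
  fixes M :: "'w measure" and U \<nu> :: "'u measure" and X :: "nat \<Rightarrow> 'w \<Rightarrow> 'u"
    and \<W> :: "'u set set" and \<B> :: "real set set"
  assumes "prob_space M"
    and "prob_space.indep_vars M (\<lambda>_. U) X {1..}"
    and "\<And>i. i \<ge> 1 \<Longrightarrow> distr M U (X i) = \<nu>"
    and "\<W> \<subseteq> sets U" and "VC_class \<W>"
    and "\<And>B. B \<in> \<B> \<Longrightarrow> regular_set B" and "VC_class \<B>"
    and "permissible TYPE('r::metric_space) U {indicator W | W. W \<in> \<W>}"
    and "permissible TYPE('s::metric_space) unit_interval {indicator B | B. B \<in> \<B>}"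
    and "permissible TYPE('t::metric_space) (unit_interval \<Otimes>\<^sub>M U)
           {(\<lambda>(s, u). indicator B s * indicator W u) | B W. B \<in> \<B> \<and> W \<in> \<W>}"
  shows "\<P>(\<omega> in completion M.
           (\<lambda>n. SUP B\<in>\<B>. SUP W\<in>\<W>.
              ennreal \<bar>emp_prod (\<lambda>i. X i \<omega>) n B W - measure (grid_measure n) B * measure \<nu> W\<bar>)
           \<longlonglongrightarrow> 0) = 1
       \<and> ((\<lambda>n. SUP B\<in>\<B>. ennreal \<bar>measure (grid_measure n) B - measure lborel B\<bar>) \<longlonglongrightarrow> 0 \<longrightarrow>
         \<P>(\<omega> in completion M.
           (\<lambda>n. SUP B\<in>\<B>. SUP W\<in>\<W>.
              ennreal \<bar>emp_prod (\<lambda>i. X i \<omega>) n B W - measure lborel B * measure \<nu> W\<bar>)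
           \<longlonglongrightarrow> 0) = 1)"
proof -
  obtain d where d: "\<And>A. finite A \<Longrightarrow> shatters \<W> A \<Longrightarrow> card A \<le> d"
    using VC_class_bound[OF \<open>VC_class \<W>\<close>] by blast
  obtain d' where d': "\<And>A. finite A \<Longrightarrow> shatters \<B> A \<Longrightarrow> card A \<le> d'"
    using VC_class_bound[OF \<open>VC_class \<B>\<close>] by blast
  interpret prob_space M by fact
  interpret vc_iid_sequence M U \<nu> X \<W> d
    using assms(2-4) d by unfold_locales auto
  let ?D = "\<lambda>\<omega> n B W. \<bar>emp_prod (\<lambda>i. X i \<omega>) n B W - measure (grid_measure n) B * measure \<nu> W\<bar>"
  let ?L = "\<lambda>\<omega> n B W. \<bar>emp_prod (\<lambda>i. X i \<omega>) n B W - measure lborel B * measure \<nu> W\<bar>"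
  let ?G = "\<lambda>n B. \<bar>measure (grid_measure n) B - measure lborel B\<bar>"
  have borel: "B \<in> sets borel \<and> B \<subseteq> {0..1}" if "B \<in> \<B>" for B
    using assms(6)[OF that] by (simp add: regular_set_def)
  have first: "AE \<omega> in M. (\<lambda>n. SUP B\<in>\<B>. SUP W\<in>\<W>. ennreal (?D \<omega> n B W)) \<longlonglongrightarrow> 0"
    by (rule AE_emp_prod_uniform_limit[OF assms(8) d' borel])
  \<comment> \<open>A deterministic step for each \<open>\<omega>\<close>: passing from grid measure
    to Lebesgue measure costs at most \<open>?G n B\<close>, uniformly in \<open>W\<close>, because
    \<open>measure \<nu> W \<le> 1\<close>.\<close>
  have second: "(\<lambda>n. SUP B\<in>\<B>. SUP W\<in>\<W>. ennreal (?L \<omega> n B W)) \<longlonglongrightarrow> 0"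
    if D: "(\<lambda>n. SUP B\<in>\<B>. SUP W\<in>\<W>. ennreal (?D \<omega> n B W)) \<longlonglongrightarrow> 0"
      and G: "(\<lambda>n. SUP B\<in>\<B>. ennreal (?G n B)) \<longlonglongrightarrow> 0" for \<omega>
  proof (rule tendsto_sandwich[OF _ _ tendsto_const])
    show "(\<lambda>n. (SUP B\<in>\<B>. SUP W\<in>\<W>. ennreal (?D \<omega> n B W)) + (SUP B\<in>\<B>. ennreal (?G n B))) \<longlonglongrightarrow> 0"
      using tendsto_add[OF D G] by simp
    have "(SUP B\<in>\<B>. SUP W\<in>\<W>. ennreal (?L \<omega> n B W)) \<le>
        (SUP B\<in>\<B>. SUP W\<in>\<W>. ennreal (?D \<omega> n B W)) + (SUP B\<in>\<B>. ennreal (?G n B))" for n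
    proof (intro SUP_least)
      fix B W assume BW: "B \<in> \<B>" "W \<in> \<W>"
      have "measure \<nu> W \<le> 1" using prob_space.prob_le_1[OF prob_space_\<nu>] .
      then have "?G n B * measure \<nu> W \<le> ?G n B" by (intro mult_left_le) auto
      then have "\<bar>measure (grid_measure n) B * measure \<nu> W - measure lborel B * measure \<nu> W\<bar> \<le> ?G n B"
        by (simp only: left_diff_distrib[symmetric] abs_mult abs_of_nonneg[OF measure_nonneg])
      then have "?L \<omega> n B W \<le> ?D \<omega> n B W + ?G n B" by linarith
      then have "ennreal (?L \<omega> n B W) \<le> ennreal (?D \<omega> n B W) + ennreal (?G n B)"
        unfolding ennreal_plus[OF abs_ge_zero abs_ge_zero, symmetric] by (rule ennreal_leI)
      also have "\<dots> \<le> (SUP B\<in>\<B>. SUP W\<in>\<W>. ennreal (?D \<omega> n B W)) + (SUP B\<in>\<B>. ennreal (?G n B))"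
        using BW by (intro add_mono SUP_upper2[of B] SUP_upper2[of W]) auto
      finally show "ennreal (?L \<omega> n B W) \<le> \<dots>" .
    qed
    then show "\<forall>\<^sub>F n in sequentially. (SUP B\<in>\<B>. SUP W\<in>\<W>. ennreal (?L \<omega> n B W)) \<le>
        (SUP B\<in>\<B>. SUP W\<in>\<W>. ennreal (?D \<omega> n B W)) + (SUP B\<in>\<B>. ennreal (?G n B))"
      by (rule always_eventually[OF allI])
  qed simp
  show ?thesis
  proof (intro conjI impI prob_completion_eq_1 \<open>prob_space M\<close>)
    assume G: "(\<lambda>n. SUP B\<in>\<B>. ennreal (?G n B)) \<longlonglongrightarrow> 0"
    show "AE \<omega> in M. (\<lambda>n. SUP B\<in>\<B>. SUP W\<in>\<W>. ennreal (?L \<omega> n B W)) \<longlonglongrightarrow> 0"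
      using first by (rule AE_mp) (intro AE_I2 impI second G)
  qed (rule first)
qed

end
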